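(* Let $G$ be a countable discrete abelian group and let $(X,\mathcal B,\mu,(T_g)_{g\in G})$ be a measure-preserving $G$-system (not necessarily ergodic). Let $A\in\mathcal B$, $k\in\mathbb N$ and $\varepsilon>0$. There is a syndetic set $S\subseteq\mathrm{Hom}(G,G)^k$ such that for every $(\varphi_1,\dots,\varphi_k)\in S$ the set $$R_\varepsilon(\varphi_1,\dots,\varphi_k):=\Big\{g\in G:\mu\Big(\bigcap_{\omega\in\{0,1\}^k}T^{-1}_{(\omega_1\varphi_1+\cdots+\omega_k\varphi_k)(g)}A\Big)>\mu(A)^{2^k}-\varepsilon\Big\}$$ is syndetic in $G$.
   Context: $\mathrm{Hom}(G,G)$ is the abelian group of homomorphisms $G\to G$ under pointwise addition, with the topology of pointwise convergence ($\varphi_n\to\varphi$ iff for each $g$, $\varphi_n(g)=\varphi(g)$ eventually); it is a locally compact abelian group, and $\mathrm{Hom}(G,G)^k$ carries the product topology. A subset $S$ of a locally compact abelian group $\Gamma$ is syndetic if there is a compact $K\subseteq\Gamma$ with $S+K=\Gamma$; for discrete $G$ this means finitely many translates of $S$ cover $G$. *)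

theory Defs
  imports "HOL-Probability.Probability"
begin

definition mp_G_system :: "'x measure \<Rightarrow> ('g::ab_group_add \<Rightarrow> 'x \<Rightarrow> 'x) \<Rightarrow> bool" where
  "mp_G_system M T \<longleftrightarrow> prob_space M
     \<and> (\<forall>g. T g \<in> measurable M M \<and> distr M M (T g) = M)
     \<and> (\<forall>x\<in>space M. T 0 x = x)
     \<and> (\<forall>g h. \<forall>x\<in>space M. T (g + h) x = T g (T h x))"

definition Hom :: "('g::ab_group_add \<Rightarrow> 'g) set" where
  "Hom = {\<phi>. \<forall>x y. \<phi> (x + y) = \<phi> x + \<phi> y}"

definition hom_top :: "('g::ab_group_add \<Rightarrow> 'g) topology" where
  "hom_top = subtopology (product_topology (\<lambda>_. discrete_topology UNIV) UNIV) Hom"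

text \<open>Hom(G,G)^k with the product topology; k-tuples are functions on {..<k}
  (extensional, i.e. undefined outside {..<k}).\<close>
definition homk_top :: "nat \<Rightarrow> (nat \<Rightarrow> ('g::ab_group_add \<Rightarrow> 'g)) topology" where
  "homk_top k = product_topology (\<lambda>_. hom_top) {..<k}"

definition tuple_add :: "nat \<Rightarrow> (nat \<Rightarrow> ('g::ab_group_add \<Rightarrow> 'g)) \<Rightarrow> (nat \<Rightarrow> ('g \<Rightarrow> 'g))
    \<Rightarrow> (nat \<Rightarrow> ('g \<Rightarrow> 'g))" where
  "tuple_add k s c = restrict (\<lambda>i. \<lambda>g. s i g + c i g) {..<k}"

definition syndetic_homk :: "nat \<Rightarrow> (nat \<Rightarrow> ('g::ab_group_add \<Rightarrow> 'g)) set \<Rightarrow> bool" where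
  "syndetic_homk k S \<longleftrightarrow> (\<exists>K. compactin (homk_top k) K \<and>
      topspace (homk_top k) = {tuple_add k s c | s c. s \<in> S \<and> c \<in> K})"

definition syndetic_discrete :: "'g::ab_group_add set \<Rightarrow> bool" where
  "syndetic_discrete R \<longleftrightarrow> (\<exists>F. finite F \<and> (\<Union>f\<in>F. (\<lambda>r. f + r) ` R) = UNIV)"

text \<open>R_eps(phi_1..phi_k); omega in {0,1}^k is encoded as the subset of {..<k} where omega_i = 1.\<close>
definition R_eps :: "'x measure \<Rightarrow> ('g::ab_group_add \<Rightarrow> 'x \<Rightarrow> 'x) \<Rightarrow> 'x set \<Rightarrow> nat \<Rightarrow> real
    \<Rightarrow> (nat \<Rightarrow> ('g \<Rightarrow> 'g)) \<Rightarrow> 'g set" where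
  "R_eps M T A k \<epsilon> \<phi> = {g. measure M (\<Inter>\<omega>\<in>Pow {..<k}. T (\<Sum>i\<in>\<omega>. \<phi> i g) -` A \<inter> space M)
      > measure M A ^ (2 ^ k) - \<epsilon>}"

end

theory Submission
  imports Defs "HOL-Library.Function_Algebras"
begin

text \<open>
  Fix an invariant mean \<open>m\<close> on \<open>G\<close>. On \<open>G \<times> X\<close> with the finitely additive integral
  \<open>F \<mapsto> m\<^sub>g \<integral> F (g, x) d\<mu>\<close> the group \<open>Hom(G,G)\<close> acts by \<open>(g, x) \<mapsto> (g, T\<^bsub>\<phi>(g)\<^esub> x)\<close>, and the mean over \<open>g\<close> of the
  measures in the theorem is a cube correlation of this action. By Khintchine recurrence for cubes
  it is almost \<open>\<mu>(A)\<close> to the power \<open>2\<close> to the \<open>k\<close> for a syndetic (even for the discrete topology) set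
  of tuples. For such a tuple, the sequence of measures has the same mean over all
  translates of a suitable finite pattern in \<open>G\<close>, because multiple averages along commuting actions
  converge uniformly (Walsh); hence large values occur syndetically. The same convergence, over
  \<open>Hom(G,G)\<close> to the power \<open>k\<close>, gives the uniformity in the Khintchine statement.

  Walsh's theorem is proved by induction on the number of actions, with an energy decrement splitting
  the last function into a structured part and a part with small averages. It is carried out for
  finitely additive systems, so that the uniformity needed in the induction step is
  the induction hypothesis for a system fibred over \<open>G\<close>.
\<close>

section \<open>Averages over lists and asymptotically invariant lists\<close>

text \<open>Lists rather than finite sets, so that coinciding points keep their weight:
  \<open>map\<close> and \<open>conv\<close> then turn averages into averages without injectivity
  conditions. The average over \<open>[]\<close> is 0 by the convention for division by
  zero.\<close>

definition av :: "'a list \<Rightarrow> ('a \<Rightarrow> real) \<Rightarrow> real" where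
  "av xs f = (\<Sum>x\<leftarrow>xs. f x) / real (length xs)"

definition conv :: "'a::plus list \<Rightarrow> 'a list \<Rightarrow> 'a list" where
  "conv xs ys = concat (map (\<lambda>x. map (\<lambda>y. x + y) ys) xs)"

lemma av_const [simp]: "xs \<noteq> [] \<Longrightarrow> av xs (\<lambda>_. c) = c"
  by (simp add: av_def sum_list_triv)

lemma av_add: "av xs (\<lambda>x. f x + g x) = av xs f + av xs g"
  by (simp add: av_def sum_list_addf add_divide_distrib)

lemma av_diff: "av xs (\<lambda>x. f x - g x) = av xs f - av xs g"
  by (simp add: av_def sum_list_subtractf diff_divide_distrib)

lemma av_cmult: "av xs (\<lambda>x. c * f x) = c * av xs f"
  by (simp add: av_def sum_list_const_mult)

lemma av_cmult_right: "av xs (\<lambda>x. f x * c) = av xs f * c"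
  using av_cmult[of xs c f] by (simp add: mult.commute)

lemma av_mono: "(\<And>x. x \<in> set xs \<Longrightarrow> f x \<le> g x) \<Longrightarrow> av xs f \<le> av xs g"
  by (auto simp: av_def intro!: divide_right_mono sum_list_mono)

lemma av_cong: "(\<And>x. x \<in> set xs \<Longrightarrow> f x = g x) \<Longrightarrow> av xs f = av xs g"
  by (simp add: av_def cong: map_cong)

lemma av_le: "xs \<noteq> [] \<Longrightarrow> (\<And>x. x \<in> set xs \<Longrightarrow> f x \<le> c) \<Longrightarrow> av xs f \<le> c"
  using av_mono[of xs f "\<lambda>_. c"] by simp

lemma av_nonneg: "(\<And>x. 0 \<le> f x) \<Longrightarrow> 0 \<le> av xs f"
  by (auto simp: av_def intro!: divide_nonneg_nonneg sum_list_nonneg)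

lemma av_abs: "\<bar>av xs f\<bar> \<le> av xs (\<lambda>x. \<bar>f x\<bar>)"
  using sum_list_abs[of "map f xs"] by (simp add: av_def o_def divide_right_mono)

lemma av_abs_le:
  assumes "xs \<noteq> []" "\<And>x. x \<in> set xs \<Longrightarrow> \<bar>f x\<bar> \<le> c" shows "\<bar>av xs f\<bar> \<le> c"
  using av_abs[of xs f] av_le[of xs "\<lambda>x. \<bar>f x\<bar>" c] assms by fastforce

lemma av_map: "av (map h xs) f = av xs (\<lambda>x. f (h x))"
  by (simp add: av_def o_def)

lemma av_Cons: "av (x # xs) f = (f x + real (length xs) * av xs f) / real (Suc (length xs))"
  by (simp add: av_def)

lemma conv_Cons: "conv (x # xs) ys = map (\<lambda>y. x + y) ys @ conv xs ys"
  by (simp add: conv_def)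

lemma length_conv: "length (conv xs ys) = length xs * length ys"
  by (induction xs) (auto simp: conv_Cons conv_def)

lemma conv_eq_Nil [simp]: "conv xs ys = [] \<longleftrightarrow> xs = [] \<or> ys = []"
  using length_conv[of xs ys] by (metis length_0_conv mult_eq_0_iff)

lemma av_conv: "av (conv xs ys) f = av xs (\<lambda>x. av ys (\<lambda>y. f (x + y)))"
proof -
  have "(\<Sum>z\<leftarrow>conv xs ys. f z) = (\<Sum>x\<leftarrow>xs. \<Sum>y\<leftarrow>ys. f (x + y))"
    by (induction xs) (auto simp: conv_Cons o_def conv_def)
  then show ?thesis
    by (simp add: av_def length_conv divide_inverse sum_list_mult_const)
qed

lemma av_swap: "av xs (\<lambda>x. av ys (\<lambda>y. f x y)) = av ys (\<lambda>y. av xs (\<lambda>x. f x y))"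
proof (induction xs)
  case Nil then show ?case by (simp add: av_def)
next
  case (Cons x xs)
  have "av ys (\<lambda>y. av (x # xs) (\<lambda>x. f x y))
      = av ys (\<lambda>y. (1 / real (Suc (length xs))) * (f x y + real (length xs) * av xs (\<lambda>x. f x y)))"
    by (simp add: av_Cons)
  also have "\<dots> = (1 / real (Suc (length xs))) * (av ys (f x) + real (length xs) * av ys (\<lambda>y. av xs (\<lambda>x. f x y)))"
    by (simp only: av_cmult av_add)
  finally show ?case by (simp add: av_Cons Cons.IH)
qed

text \<open>Amenability of abelian groups. A long progression 0, g, 2g, ... is almost invariant
  under g by telescoping; convolving the list found so far with it adds this condition and, by
  commutativity, keeps the earlier ones.\<close>

lemma ex_asymp_invariant_list:
  fixes E :: "('g::ab_group_add \<times> nat) set"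
  assumes "finite E"
  shows "\<exists>xs. xs \<noteq> [] \<and> (\<forall>(g, n)\<in>E. \<forall>a. (\<forall>x. \<bar>a x\<bar> \<le> 1) \<longrightarrow>
           \<bar>av xs (\<lambda>x. a (x + g)) - av xs a\<bar> \<le> 1 / real (Suc n))"
  using assms
proof (induction E)
  case empty
  show ?case by (rule exI[of _ "[0]"]) simp
next
  case (insert p E)
  obtain g n where p: "p = (g, n)" by (cases p)
  from insert.IH obtain xs where xs: "xs \<noteq> []"
    "\<And>h m a. (h, m) \<in> E \<Longrightarrow> (\<forall>x. \<bar>a x\<bar> \<le> 1) \<Longrightarrow> \<bar>av xs (\<lambda>x. a (x + h)) - av xs a\<bar> \<le> 1 / real (Suc m)"
    by fastforce
  \<comment> \<open>The telescoped sum has only two boundary terms, each at most 1 in absolute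
    value, so this length gives exactly the tolerance 1 / (n + 1).\<close>
  define N where "N = 2 * Suc n"
  define ys where "ys = map (\<lambda>j. ((+) g ^^ j) (0::'g)) [0..<N]"
  have ys0: "ys \<noteq> []" by (simp add: ys_def N_def)
  have new: "\<bar>av ys (\<lambda>y. a (y + g)) - av ys a\<bar> \<le> 1 / real (Suc n)" if a: "\<And>x. \<bar>a x\<bar> \<le> 1" for a
  proof -
    have "av ys (\<lambda>y. a (y + g)) - av ys a
        = (\<Sum>j<N. a (((+) g ^^ Suc j) 0) - a (((+) g ^^ j) 0)) / real N"
      by (simp add: ys_def av_map sum_subtractf diff_divide_distrib av_def add.commute
          interv_sum_list_conv_sum_set_nat atLeast0LessThan o_def)
    also have "\<dots> = (a (((+) g ^^ N) 0) - a 0) / real N"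
      by (subst sum_lessThan_telescope) simp
    finally have "\<bar>av ys (\<lambda>y. a (y + g)) - av ys a\<bar> = \<bar>a (((+) g ^^ N) 0) - a 0\<bar> / real N" by simp
    also have "\<dots> \<le> 2 / real N"
      using a[of "((+) g ^^ N) 0"] a[of 0] by (intro divide_right_mono) auto
    finally show ?thesis by (simp add: N_def field_simps)
  qed
  have "\<bar>av (conv xs ys) (\<lambda>x. a (x + h)) - av (conv xs ys) a\<bar> \<le> 1 / real (Suc m)"
    if hm: "(h, m) \<in> insert p E" and a: "\<forall>x. \<bar>a x\<bar> \<le> 1" for h m a
  proof (cases "(h, m) \<in> E")
    case True
    have "av (conv xs ys) (\<lambda>x. a (x + h)) - av (conv xs ys) a
        = av ys (\<lambda>y. av xs (\<lambda>x. a (x + h + y)) - av xs (\<lambda>x. a (x + y)))"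
      by (subst (1 2) av_conv, subst (1 2) av_swap) (simp add: av_diff algebra_simps)
    then show ?thesis using xs(2)[OF True, of "\<lambda>x. a (x + _)"] a ys0
      by (auto intro!: av_abs_le)
  next
    case False
    with hm p have [simp]: "h = g" "m = n" by auto
    have "av (conv xs ys) (\<lambda>x. a (x + h)) - av (conv xs ys) a
        = av xs (\<lambda>x. av ys (\<lambda>y. a (x + (y + g))) - av ys (\<lambda>y. a (x + y)))"
      by (simp add: av_conv av_diff algebra_simps)
    then show ?thesis using new[of "\<lambda>y. a (_ + y)"] a xs(1)
      by (auto intro!: av_abs_le)
  qed
  then show ?case using xs(1) ys0 by (intro exI[of _ "conv xs ys"]) auto
qed

section \<open>Generalised limits and invariant means\<close>

definition bdd :: "('i \<Rightarrow> real) \<Rightarrow> bool" where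
  "bdd a \<longleftrightarrow> (\<exists>C. \<forall>i. \<bar>a i\<bar> \<le> C)"

lemma bddI: "(\<And>i. \<bar>a i\<bar> \<le> C) \<Longrightarrow> bdd a"
  by (auto simp: bdd_def)

lemma bddE: assumes "bdd a" obtains C where "C > 0" "\<And>i. \<bar>a i\<bar> \<le> C"
proof -
  from assms obtain C where "\<And>i. \<bar>a i\<bar> \<le> C" by (auto simp: bdd_def)
  then have "\<bar>a i\<bar> \<le> max 1 C" for i by (simp add: le_max_iff_disj)
  then show ?thesis using that[of "max 1 C"] by auto
qed

lemma bdd_const [simp]: "bdd (\<lambda>_. c)"
  by (auto simp: bdd_def)

lemma bdd_add [intro]: assumes "bdd a" "bdd b" shows "bdd (\<lambda>i. a i + b i)"
proof -
  obtain C D where "\<And>i. \<bar>a i\<bar> \<le> C" "\<And>i. \<bar>b i\<bar> \<le> D" using assms by (auto elim!: bddE)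
  then show ?thesis
    by (intro bddI[of _ "C + D"]) (metis abs_triangle_ineq add_mono order_trans)
qed

lemma bdd_mult [intro]: assumes "bdd a" "bdd b" shows "bdd (\<lambda>i. a i * b i)"
proof -
  obtain C D where "C > 0" "\<And>i. \<bar>a i\<bar> \<le> C" "\<And>i. \<bar>b i\<bar> \<le> D" using assms by (auto elim!: bddE)
  then show ?thesis by (intro bddI[of _ "C * D"]) (auto simp: abs_mult intro!: mult_mono)
qed

lemma bdd_comp: "bdd a \<Longrightarrow> bdd (\<lambda>i. a (h i))"
  by (auto simp: bdd_def)

lemma bdd_av:
  assumes "bdd a" "\<And>i. ys i \<noteq> []" shows "bdd (\<lambda>i. av (ys i) (\<lambda>x. a (h i x)))"
proof -
  obtain C where "\<And>i. \<bar>a i\<bar> \<le> C" using assms by (auto elim!: bddE)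
  then show ?thesis using assms by (auto intro!: bddI[of _ C] av_abs_le)
qed

locale mean =
  fixes L :: "('i \<Rightarrow> real) \<Rightarrow> real"
  assumes add: "bdd a \<Longrightarrow> bdd b \<Longrightarrow> L (\<lambda>i. a i + b i) = L a + L b"
    and cmult: "bdd a \<Longrightarrow> L (\<lambda>i. c * a i) = c * L a"
    and nonneg: "bdd a \<Longrightarrow> (\<And>i. 0 \<le> a i) \<Longrightarrow> 0 \<le> L a"
    and one: "L (\<lambda>_. 1) = 1"
begin

lemma const [simp]: "L (\<lambda>_. c) = c"
  using cmult[of "\<lambda>_. 1" c] one by simp

lemma diff: "bdd a \<Longrightarrow> bdd b \<Longrightarrow> L (\<lambda>i. a i - b i) = L a - L b"
  using add[of a "\<lambda>i. (-1) * b i"] cmult[of b "-1"] bdd_mult[of "\<lambda>_. -1" b] by simp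

lemma mono: 
  assumes "bdd a" "bdd b" "\<And>i. a i \<le> b i" shows "L a \<le> L b"
proof -
  have "bdd (\<lambda>i. b i - a i)"
    using bdd_add[OF assms(2) bdd_mult[OF bdd_const[of "-1"] assms(1)]] by simp
  then have "0 \<le> L (\<lambda>i. b i - a i)" using assms by (intro nonneg) auto
  then show ?thesis using assms diff by simp
qed

lemma ge: "bdd a \<Longrightarrow> (\<And>i. c \<le> a i) \<Longrightarrow> c \<le> L a"
  using mono[of "\<lambda>_. c" a] by simp

lemma le: "bdd a \<Longrightarrow> (\<And>i. a i \<le> c) \<Longrightarrow> L a \<le> c"
  using mono[of a "\<lambda>_. c"] by simp

lemma abs_le: 
  assumes "\<And>i. \<bar>a i\<bar> \<le> c" shows "\<bar>L a\<bar> \<le> c"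
proof -
  have "bdd a" using assms by (rule bddI)
  moreover have "- c \<le> a i" "a i \<le> c" for i using assms[of i] by linarith+
  ultimately show ?thesis using le[of a c] ge[of a "-c"] by (auto simp: abs_le_iff)
qed

lemma average:
  assumes "\<And>x. x \<in> set xs \<Longrightarrow> bdd (\<lambda>i. a i x)"
  shows "L (\<lambda>i. av xs (a i)) = av xs (\<lambda>x. L (\<lambda>i. a i x)) \<and> bdd (\<lambda>i. av xs (a i))"
  using assms
proof (induction xs)
  case Nil then show ?case by (simp add: av_def)
next
  case (Cons x xs)
  have eq: "av (x # xs) f = (1 / real (Suc (length xs))) * (f x + real (length xs) * av xs f)" for f
    by (simp add: av_Cons)
  have b: "bdd (\<lambda>i. a i x)" "bdd (\<lambda>i. av xs (a i))" using Cons by auto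
  have b': "bdd (\<lambda>i. real (length xs) * av xs (a i))" "bdd (\<lambda>i. a i x + real (length xs) * av xs (a i))"
    using bdd_mult[OF bdd_const b(2)] b by auto
  have "L (\<lambda>i. av xs (a i)) = av xs (\<lambda>x. L (\<lambda>i. a i x))" using Cons by auto
  then show ?case unfolding eq
    using cmult[OF b'(2), of "1 / real (Suc (length xs))"] add[OF b(1) b'(1)]
      cmult[OF b(2), of "real (length xs)"] bdd_mult[OF bdd_const b'(2), of "1 / real (Suc (length xs))"]
    by simp
qed

lemma square_ge: 
  assumes "bdd a" shows "(L a)\<^sup>2 \<le> L (\<lambda>i. (a i)\<^sup>2)"
proof -
  have b: "bdd (\<lambda>i. (a i)\<^sup>2)" using assms by (auto simp: power2_eq_square)
  have "0 \<le> L (\<lambda>i. (a i - L a)\<^sup>2)" 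
    using bdd_add[OF assms bdd_const[of "- L a"]] by (intro nonneg) (auto simp: power2_eq_square)
  also have "(\<lambda>i. (a i - L a)\<^sup>2) = (\<lambda>i. ((a i)\<^sup>2 + (- 2 * L a) * a i) + (L a)\<^sup>2)"
    by (auto simp: power2_eq_square algebra_simps)
  also have "L \<dots> = L (\<lambda>i. (a i)\<^sup>2) + (- 2 * L a) * L a + (L a)\<^sup>2"
  proof -
    have b1: "bdd (\<lambda>i. (- 2 * L a) * a i)" using bdd_mult[OF bdd_const assms] .
    show ?thesis 
      using add[OF bdd_add[OF b b1] bdd_const[of "(L a)\<^sup>2"]] add[OF b b1] cmult[OF assms, of "- 2 * L a"]
      by simp
  qed
  finally show ?thesis by (simp add: power2_eq_square)
qed

text \<open>Jensen's inequality by iterated squaring; cubes produce no exponents other than powers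
  of two.\<close>

lemma power_ge:
  assumes "bdd a" "\<And>i. 0 \<le> a i" shows "(L a) ^ (2 ^ k) \<le> L (\<lambda>i. (a i) ^ (2 ^ k)) \<and> bdd (\<lambda>i. (a i) ^ (2 ^ k))"
proof (induction k)
  case 0 then show ?case using assms by simp
next
  case (Suc k)
  have "(L a) ^ (2 ^ Suc k) = ((L a) ^ (2 ^ k))\<^sup>2" by (simp add: power_even_eq)
  also have "\<dots> \<le> (L (\<lambda>i. (a i) ^ (2 ^ k)))\<^sup>2"
    using Suc nonneg[OF assms] by (intro power_mono) auto
  also have "\<dots> \<le> L (\<lambda>i. ((a i) ^ (2 ^ k))\<^sup>2)" using Suc by (intro square_ge) auto
  finally show ?case using Suc by (auto simp: power_even_eq power2_eq_square[of "_ ^ _"])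
qed

end

text \<open>Evaluation at a point i is a mean. The evaluations lie in a compact product of
  intervals, and a cluster point of them along \<open>F\<close> is again a mean, because all
  defining conditions are closed.\<close>

lemma ex_generalised_limit:
  fixes F :: "'i filter"
  assumes "F \<noteq> bot"
  shows "\<exists>L. mean L \<and> (\<forall>a l. bdd a \<longrightarrow> (a \<longlongrightarrow> l) F \<longrightarrow> L a = l)"
proof -
  define C where "C a = (SOME C::real. \<forall>i::'i. \<bar>a i\<bar> \<le> C)" for a
  have C: "\<bar>a i\<bar> \<le> C a" if "bdd a" for a i
    using that someI_ex[of "\<lambda>C. \<forall>i. \<bar>a i\<bar> \<le> C"] by (auto simp: bdd_def C_def)
  \<comment> \<open>Unbounded functions get the value 0, so that every coordinate stays in a compact
    set.\<close>
  define \<delta> where "\<delta> i a = (if bdd a then a i else 0)" for i :: 'i and a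
  define K where "K = (\<Pi>\<^sub>E a\<in>UNIV. (if bdd a then {- C a..C a} else {0::real}))"
  have "compactin (product_topology (\<lambda>_. euclidean) UNIV) K"
    unfolding K_def by (subst compactin_PiE) auto
  then have "compact K" by (simp add: euclidean_product_topology)
  moreover have "\<delta> i \<in> K" for i
    using C by (auto simp: K_def \<delta>_def abs_le_iff minus_le_iff)
  then have "eventually (\<lambda>x. x \<in> K) (filtermap \<delta> F)" by (simp add: eventually_filtermap)
  ultimately obtain x where x: "inf (nhds x) (filtermap \<delta> F) \<noteq> bot"
    using assms unfolding compact_filter by (metis filtermap_bot_iff)
  \<comment> \<open>Transfer principle: a closed condition that the evaluations satisfy eventually
    along \<open>F\<close> passes to the cluster point.\<close>
  have cl: "Q x" if "closed {x. Q x}" "eventually (\<lambda>i. Q (\<delta> i)) F" for Q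
  proof (rule ccontr)
    assume "\<not> Q x"
    then have "eventually (\<lambda>y. \<not> Q y) (nhds x)"
      using that(1) eventually_nhds[of "\<lambda>y. \<not> Q y" x] by (auto simp: closed_def Collect_neg_eq intro!: exI[of _ "- {x. Q x}"])
    moreover have "eventually Q (filtermap \<delta> F)" using that(2) by (simp add: eventually_filtermap)
    ultimately have "eventually (\<lambda>_. False) (inf (nhds x) (filtermap \<delta> F))"
      by (auto simp: eventually_inf)
    then show False using x by (simp add: eventually_False)
  qed
  have co: "continuous_on UNIV (\<lambda>x. x a)" for a :: "'i \<Rightarrow> real"
    by (rule continuous_on_product_coordinates)
  have "mean x"
  proof
    fix a b :: "'i \<Rightarrow> real" assume "bdd a" "bdd b"
    then show "x (\<lambda>i. a i + b i) = x a + x b"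
      by (intro cl[of "\<lambda>x. x (\<lambda>i. a i + b i) = x a + x b"] closed_Collect_eq continuous_intros co)
         (auto simp: \<delta>_def intro!: always_eventually)
  next
    fix a c assume "bdd (a :: 'i \<Rightarrow> real)"
    then show "x (\<lambda>i. c * a i) = c * x a"
      by (intro cl[of "\<lambda>x. x (\<lambda>i. c * a i) = c * x a"] closed_Collect_eq continuous_intros co)
         (auto simp: \<delta>_def intro!: always_eventually)
  next
    fix a assume "bdd (a :: 'i \<Rightarrow> real)" "\<And>i. 0 \<le> a i"
    then show "0 \<le> x a"
      by (intro cl[of "\<lambda>x. 0 \<le> x a"] closed_Collect_le continuous_intros co)
         (auto simp: \<delta>_def intro!: always_eventually)
  next
    show "x (\<lambda>_. 1) = 1"
      by (intro cl[of "\<lambda>x. x (\<lambda>_. 1) = 1"] closed_Collect_eq continuous_intros co)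
         (auto simp: \<delta>_def intro!: always_eventually)
  qed
  moreover have "x a = l" if a: "bdd a" "(a \<longlongrightarrow> l) F" for a l
  proof -
    have "\<bar>x a - l\<bar> \<le> e" if "e > 0" for e
    proof (intro cl[of "\<lambda>x. \<bar>x a - l\<bar> \<le> e"] closed_Collect_le continuous_intros co)
      show "eventually (\<lambda>i. \<bar>\<delta> i a - l\<bar> \<le> e) F"
        using tendstoD[OF a(2) \<open>e > 0\<close>] by eventually_elim (use a in \<open>auto simp: \<delta>_def dist_real_def\<close>)
    qed
    then show ?thesis by (metis abs_le_zero_iff eq_iff_diff_eq_0 field_le_epsilon add_0)
  qed
  ultimately show ?thesis by blast
qed

text \<open>A finite set of pairs (translation, tolerance) is read as a set of invariance conditions;
  the limit is taken as it grows.\<close>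

lemma ex_limit_along_invariant_lists:
  fixes ys :: "('g::ab_group_add \<times> nat) set \<Rightarrow> 'g list"
  assumes "\<And>E g n a. finite E \<Longrightarrow> (g, n) \<in> E \<Longrightarrow> (\<forall>x. \<bar>a x\<bar> \<le> 1) \<Longrightarrow>
      \<bar>av (ys E) (\<lambda>x. a (x + g)) - av (ys E) a\<bar> \<le> 1 / real (Suc n)"
    and ne: "\<And>E. ys E \<noteq> []"
  shows "\<exists>L. mean L \<and> (\<forall>a g C. (\<forall>E x. \<bar>a E x\<bar> \<le> C) \<longrightarrow>
           L (\<lambda>E. av (ys E) (\<lambda>x. a E (x + g))) = L (\<lambda>E. av (ys E) (a E)))"
proof -
  obtain L where L: "mean L" 
    "\<And>a l. bdd a \<Longrightarrow> (a \<longlongrightarrow> l) (finite_subsets_at_top (UNIV :: ('g \<times> nat) set)) \<Longrightarrow> L a = l"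
    using ex_generalised_limit[OF finite_subsets_at_top_neq_bot] by metis
  interpret mean L by fact
  have "L (\<lambda>E. av (ys E) (\<lambda>x. a E (x + g))) = L (\<lambda>E. av (ys E) (a E))" 
    if aC: "\<And>E x. \<bar>a E x\<bar> \<le> C" for a g C
  proof -
    define D where "D = max 1 C"
    have D: "D > 0" "\<And>E x. \<bar>a E x\<bar> \<le> D" using aC by (auto simp: D_def le_max_iff_disj)
    have b: "bdd (\<lambda>E. av (ys E) (\<lambda>x. a E (x + g)))" "bdd (\<lambda>E. av (ys E) (a E))"
      using D ne by (auto intro!: bddI[of _ D] av_abs_le)
    let ?d = "\<lambda>E. av (ys E) (\<lambda>x. a E (x + g)) - av (ys E) (a E)"
    have "(?d \<longlongrightarrow> 0) (finite_subsets_at_top UNIV)"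
    proof (rule tendstoI)
      fix e :: real assume "e > 0"
      then obtain n where n: "D / e < real n" using reals_Archimedean2 by blast
      then have n': "D / real (Suc n) < e" using \<open>e > 0\<close> D(1)
        by (simp add: field_simps)
      have "\<bar>?d E\<bar> < e" if E: "finite E" "(g, n) \<in> E" for E
      proof -
        have "\<bar>av (ys E) (\<lambda>x. a E (x + g) / D) - av (ys E) (\<lambda>x. a E x / D)\<bar> \<le> 1 / real (Suc n)"
          using D by (intro assms(1)[OF E, of "\<lambda>x. a E x / D"]) (auto simp: abs_le_iff field_simps)
        then have "\<bar>?d E / D\<bar> \<le> 1 / real (Suc n)"
          by (simp only: divide_inverse av_cmult_right left_diff_distrib)
        then have "\<bar>?d E\<bar> \<le> D / real (Suc n)" using D(1) by (simp add: field_simps)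
        then show ?thesis using n' by simp
      qed
      then show "\<forall>\<^sub>F E in finite_subsets_at_top UNIV. dist (?d E) 0 < e"
        unfolding eventually_finite_subsets_at_top
        by (intro exI[of _ "{(g, n)}"]) auto
    qed
    moreover have "bdd ?d" using D ne by (auto intro!: bddI[of _ "D + D"] abs_triangle_ineq4[THEN order_trans] add_mono av_abs_le)
    ultimately have "L ?d = 0" by (intro L(2)) auto
    then show ?thesis using diff[OF b] by simp
  qed
  then show ?thesis using L(1) by blast
qed

lemma mean_of_averages:
  assumes "mean L" and ne: "\<And>E. ys E \<noteq> []"
  shows "mean (\<lambda>a. L (\<lambda>E. av (ys E) a))"
proof -
  interpret mean L by fact
  have b: "bdd (\<lambda>E. av (ys E) a)" if "bdd a" for a
    using bdd_av[of a ys "\<lambda>_ x. x"] that ne by simp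
  show ?thesis
  proof (unfold_locales, goal_cases)
    case (1 a c) then show ?case by (simp add: av_add add b)
  next
    case (2 a c) then show ?case by (simp add: av_cmult cmult b)
  next
    case (3 a) then show ?case by (intro nonneg b av_nonneg)
  next
    case 4 then show ?case by (simp add: ne)
  qed
qed

lemma ex_asymp_invariant_family:
  "\<exists>ys :: ('g::ab_group_add \<times> nat) set \<Rightarrow> 'g list. (\<forall>E. ys E \<noteq> []) \<and>
    (\<forall>E g n a. finite E \<longrightarrow> (g, n) \<in> E \<longrightarrow> (\<forall>x. \<bar>a x\<bar> \<le> 1) \<longrightarrow>
      \<bar>av (ys E) (\<lambda>x. a (x + g)) - av (ys E) a\<bar> \<le> 1 / real (Suc n))"
proof -
  define P :: "('g \<times> nat) set \<Rightarrow> 'g list \<Rightarrow> bool" where "P E xs \<longleftrightarrow> xs \<noteq> [] \<and>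
    (finite E \<longrightarrow> (\<forall>(g, n)\<in>E. \<forall>a. (\<forall>x. \<bar>a x\<bar> \<le> 1) \<longrightarrow>
      \<bar>av xs (\<lambda>x. a (x + g)) - av xs a\<bar> \<le> 1 / real (Suc n)))" for E xs
  have "\<exists>xs. P E xs" for E
    using ex_asymp_invariant_list[of E] by (cases "finite E") (auto simp: P_def intro: exI[of _ "[0]"])
  then obtain ys where "\<And>E. P E (ys E)" by metis
  then show ?thesis unfolding P_def by (intro exI[of _ ys]) fastforce
qed

lemma ex_invariant_mean:
  "\<exists>m :: ('g::ab_group_add \<Rightarrow> real) \<Rightarrow> real. mean m \<and> (\<forall>a g. bdd a \<longrightarrow> m (\<lambda>x. a (x + g)) = m a)"
proof -
  obtain ys :: "('g \<times> nat) set \<Rightarrow> 'g list" where ys: "\<And>E. ys E \<noteq> []"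
    "\<And>E g n a. finite E \<Longrightarrow> (g, n) \<in> E \<Longrightarrow> (\<forall>x. \<bar>a x\<bar> \<le> 1) \<Longrightarrow>
      \<bar>av (ys E) (\<lambda>x. a (x + g)) - av (ys E) a\<bar> \<le> 1 / real (Suc n)"
    using ex_asymp_invariant_family by blast
  obtain L where L: "mean L" "\<And>a g C. (\<And>E x. \<bar>a E x\<bar> \<le> C) \<Longrightarrow>
           L (\<lambda>E. av (ys E) (\<lambda>x. a E (x + g))) = L (\<lambda>E. av (ys E) (a E))"
    using ex_limit_along_invariant_lists[of ys, OF ys(2) ys(1)] by blast
  have "mean (\<lambda>a. L (\<lambda>E. av (ys E) a))" using L(1) ys(1) by (rule mean_of_averages)
  moreover have "L (\<lambda>E. av (ys E) (\<lambda>x. a (x + g))) = L (\<lambda>E. av (ys E) a)" if "bdd a" for a g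
    using that L(2)[of "\<lambda>_. a"] by (auto simp: bdd_def)
  ultimately show ?thesis by (intro exI[of _ "\<lambda>a. L (\<lambda>E. av (ys E) a)"]) auto
qed

section \<open>Finitely additive measure-preserving systems\<close>

text \<open>\<open>V\<close> stands for the bounded measurable functions and \<open>I\<close> for
  the integral. Neither countable additivity nor completeness is asked, since an invariant mean on
  the base of a fibred system provides neither.\<close>

locale mean_system =
  fixes V :: "('y \<Rightarrow> real) set" and I :: "('y \<Rightarrow> real) \<Rightarrow> real" and S :: "'h::ab_group_add \<Rightarrow> 'y \<Rightarrow> 'y"
  assumes V_bdd: "f \<in> V \<Longrightarrow> bdd f"
    and V_const: "(\<lambda>_. c) \<in> V"
    and V_add: "f \<in> V \<Longrightarrow> g \<in> V \<Longrightarrow> (\<lambda>y. f y + g y) \<in> V"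
    and V_mult: "f \<in> V \<Longrightarrow> g \<in> V \<Longrightarrow> (\<lambda>y. f y * g y) \<in> V"
    and V_shift: "f \<in> V \<Longrightarrow> (\<lambda>y. f (S h y)) \<in> V"
    and I_add: "f \<in> V \<Longrightarrow> g \<in> V \<Longrightarrow> I (\<lambda>y. f y + g y) = I f + I g"
    and I_cmult: "f \<in> V \<Longrightarrow> I (\<lambda>y. c * f y) = c * I f"
    and I_nonneg: "f \<in> V \<Longrightarrow> (\<And>y. 0 \<le> f y) \<Longrightarrow> 0 \<le> I f"
    and I_one: "I (\<lambda>_. 1) = 1"
    and I_shift: "f \<in> V \<Longrightarrow> I (\<lambda>y. f (S h y)) = I f"
    and S_0: "S 0 y = y"
    and S_add: "S (a + b) y = S a (S b y)"
begin

lemma V_cmult: "f \<in> V \<Longrightarrow> (\<lambda>y. c * f y) \<in> V"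
  by (intro V_mult V_const)

lemma V_diff: "f \<in> V \<Longrightarrow> g \<in> V \<Longrightarrow> (\<lambda>y. f y - g y) \<in> V"
  using V_add[of f "\<lambda>y. (-1) * g y"] V_cmult[of g "-1"] by simp

lemma V_square: "f \<in> V \<Longrightarrow> (\<lambda>y. (f y)\<^sup>2) \<in> V"
  by (simp add: power2_eq_square V_mult)

lemma V_prod: "(\<And>j. j \<in> J \<Longrightarrow> f j \<in> V) \<Longrightarrow> (\<lambda>y. \<Prod>j\<in>J. f j y) \<in> V"
  by (induction J rule: infinite_finite_induct) (auto intro: V_mult V_const)

lemma I_const [simp]: "I (\<lambda>_. c) = c"
  using I_cmult[OF V_const, of c 1] I_one by simp

lemma I_diff: "f \<in> V \<Longrightarrow> g \<in> V \<Longrightarrow> I (\<lambda>y. f y - g y) = I f - I g"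
  using I_add[of f "\<lambda>y. (-1) * g y"] I_cmult[of g "-1"] V_cmult[of g "-1"] by simp

lemma V_av_I_av:
  assumes "\<And>x. x \<in> set xs \<Longrightarrow> v x \<in> V"
  shows "(\<lambda>y. av xs (\<lambda>x. v x y)) \<in> V \<and> I (\<lambda>y. av xs (\<lambda>x. v x y)) = av xs (\<lambda>x. I (v x))"
  using assms
proof (induction xs)
  case Nil then show ?case by (simp add: av_def V_const)
next
  case (Cons x xs)
  have eq: "av (x # xs) f = (1 / real (Suc (length xs))) * (f x + real (length xs) * av xs f)" for f
    by (simp add: av_Cons)
  have b: "v x \<in> V" "(\<lambda>y. av xs (\<lambda>x. v x y)) \<in> V" and i: "I (\<lambda>y. av xs (\<lambda>x. v x y)) = av xs (\<lambda>x. I (v x))"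
    using Cons by auto
  note b1 = V_cmult[OF b(2), of "real (length xs)"]
  note b2 = V_add[OF b(1) b1]
  show ?case unfolding eq
    using V_cmult[OF b2, of "1 / real (Suc (length xs))"] I_cmult[OF b2, of "1 / real (Suc (length xs))"]
      I_add[OF b(1) b1] I_cmult[OF b(2), of "real (length xs)"] i
    by simp
qed

lemma V_av: "(\<And>x. v x \<in> V) \<Longrightarrow> (\<lambda>y. av xs (\<lambda>x. v x y)) \<in> V"
  and I_av: "(\<And>x. v x \<in> V) \<Longrightarrow> I (\<lambda>y. av xs (\<lambda>x. v x y)) = av xs (\<lambda>x. I (v x))"
  using V_av_I_av[of xs v] by auto

lemmas V_intros = V_const V_add V_diff V_mult V_square V_av V_prod

lemma I_mono: assumes "f \<in> V" "g \<in> V" "\<And>y. f y \<le> g y" shows "I f \<le> I g"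
  using I_nonneg[of "\<lambda>y. g y - f y"] I_diff[of g f] V_diff[of g f] assms by simp

lemma I_abs_le: assumes "f \<in> V" "\<And>y. \<bar>f y\<bar> \<le> c" shows "\<bar>I f\<bar> \<le> c"
proof -
  have "f y \<le> c" "- c \<le> f y" for y using assms(2)[of y] by linarith+
  then show ?thesis using I_mono[OF assms(1) V_const, of c] I_mono[OF V_const assms(1), of "-c"]
    by (auto simp: abs_le_iff)
qed

lemma S_neg: "S (- a) (S a y) = y" "S a (S (- a) y) = y"
  by (simp_all add: S_0 flip: S_add)

lemma I_unshift:
  assumes "f \<in> V" "g \<in> V" shows "I (\<lambda>y. f (S a y) * g y) = I (\<lambda>y. f y * g (S (- a) y))"
  using I_shift[OF V_mult[OF assms(1) V_shift[OF assms(2)]], of a "- a"] by (simp add: S_neg)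

section \<open>The L2 seminorm and approximate representation of functionals\<close>

definition nrm :: "('y \<Rightarrow> real) \<Rightarrow> real" where
  "nrm f = sqrt (I (\<lambda>y. (f y)\<^sup>2))"

lemma nrm_nonneg: "f \<in> V \<Longrightarrow> 0 \<le> nrm f"
  by (simp add: nrm_def I_nonneg V_square)

lemma nrm_square: "f \<in> V \<Longrightarrow> (nrm f)\<^sup>2 = I (\<lambda>y. (f y)\<^sup>2)"
  by (simp add: nrm_def I_nonneg V_square)

lemma I_square_add:
  assumes "f \<in> V" "g \<in> V"
  shows "I (\<lambda>y. (f y + t * g y)\<^sup>2) = I (\<lambda>y. (f y)\<^sup>2) + 2 * t * I (\<lambda>y. f y * g y) + t\<^sup>2 * I (\<lambda>y. (g y)\<^sup>2)"
proof -
  have "I (\<lambda>y. (f y + t * g y)\<^sup>2) = I (\<lambda>y. ((f y)\<^sup>2 + (2 * t) * (f y * g y)) + t\<^sup>2 * (g y)\<^sup>2)"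
    by (intro arg_cong[where f=I] ext) (simp add: power2_eq_square algebra_simps)
  also have "\<dots> = I (\<lambda>y. (f y)\<^sup>2 + (2 * t) * (f y * g y)) + I (\<lambda>y. t\<^sup>2 * (g y)\<^sup>2)"
    by (rule I_add) (intro V_intros assms)+
  also have "I (\<lambda>y. (f y)\<^sup>2 + (2 * t) * (f y * g y)) = I (\<lambda>y. (f y)\<^sup>2) + I (\<lambda>y. (2 * t) * (f y * g y))"
    by (rule I_add) (intro V_intros assms)+
  also have "I (\<lambda>y. (2 * t) * (f y * g y)) = 2 * t * I (\<lambda>y. f y * g y)"
    by (rule I_cmult) (intro V_intros assms)+
  also have "I (\<lambda>y. t\<^sup>2 * (g y)\<^sup>2) = t\<^sup>2 * I (\<lambda>y. (g y)\<^sup>2)"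
    by (rule I_cmult) (intro V_intros assms)+
  finally show ?thesis .
qed

lemma Cauchy_Schwarz:
  assumes "f \<in> V" "g \<in> V" shows "\<bar>I (\<lambda>y. f y * g y)\<bar> \<le> nrm f * nrm g"
proof -
  let ?a = "I (\<lambda>y. (f y)\<^sup>2)" and ?b = "I (\<lambda>y. f y * g y)" and ?c = "I (\<lambda>y. (g y)\<^sup>2)"
  have pos: "0 \<le> ?a + 2 * t * ?b + t\<^sup>2 * ?c" for t
    unfolding I_square_add[OF assms, symmetric] by (intro I_nonneg V_intros assms) auto
  have c0: "0 \<le> ?c" by (intro I_nonneg V_intros assms) auto
  have "?b\<^sup>2 \<le> ?a * ?c"
  proof (cases "?c = 0")
    case True
    have "?b = 0"
    proof (rule ccontr)
      assume b: "?b \<noteq> 0"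
      have "2 * (- (?a + 1) / (2 * ?b)) * ?b = - (?a + 1)" using b by simp
      then show False using pos[of "- (?a + 1) / (2 * ?b)"] True by simp
    qed
    then show ?thesis using True by simp
  next
    case False
    then have "?c > 0" using c0 by simp
    then show ?thesis using pos[of "- ?b / ?c"] by (simp add: field_simps power2_eq_square)
  qed
  then have "\<bar>?b\<bar> \<le> sqrt (?a * ?c)" by (metis real_sqrt_abs real_sqrt_le_mono)
  then show ?thesis by (simp add: nrm_def real_sqrt_mult)
qed

lemma I_abs_le_nrm: "f \<in> V \<Longrightarrow> \<bar>I f\<bar> \<le> nrm f"
  using Cauchy_Schwarz[OF _ V_const, of f 1] by (simp add: nrm_def)

text \<open>Duality: bounds on pairings, applied with the function itself as test function, become
  norm bounds. The case of seminorm 0, where one cannot divide, is settled here once and for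
  all.\<close>

lemma nrm_leI:
  assumes "f \<in> V" "0 \<le> B" "I (\<lambda>y. f y * f y) \<le> B * nrm f" shows "nrm f \<le> B"
proof (cases "nrm f = 0")
  case False
  then have "nrm f > 0" using nrm_nonneg[OF assms(1)] by simp
  moreover have "nrm f * nrm f \<le> B * nrm f"
    using assms nrm_square[OF assms(1)] by (simp add: power2_eq_square)
  ultimately show ?thesis by simp
qed (use assms in simp)

lemma nrm_triangle:
  assumes "f \<in> V" "g \<in> V" shows "nrm (\<lambda>y. f y + g y) \<le> nrm f + nrm g"
proof (rule nrm_leI)
  let ?s = "\<lambda>y. f y + g y"
  show s: "?s \<in> V" using assms by (rule V_add)
  show "0 \<le> nrm f + nrm g" using assms nrm_nonneg by simp
  have "I (\<lambda>y. ?s y * ?s y) = I (\<lambda>y. f y * ?s y + g y * ?s y)" by (simp add: algebra_simps)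
  also have "\<dots> = I (\<lambda>y. f y * ?s y) + I (\<lambda>y. g y * ?s y)" by (intro I_add V_mult assms s)
  also have "\<dots> \<le> nrm f * nrm ?s + nrm g * nrm ?s"
    using Cauchy_Schwarz[OF assms(1) s] Cauchy_Schwarz[OF assms(2) s] by linarith
  finally show "I (\<lambda>y. ?s y * ?s y) \<le> (nrm f + nrm g) * nrm ?s" by (simp add: algebra_simps)
qed

lemma nrm_cmult: "f \<in> V \<Longrightarrow> nrm (\<lambda>y. c * f y) = \<bar>c\<bar> * nrm f"
  by (simp add: nrm_def power_mult_distrib I_cmult V_square real_sqrt_mult)

lemma nrm_triangle_diff:
  assumes "f \<in> V" "g \<in> V" shows "nrm (\<lambda>y. f y - g y) \<le> nrm f + nrm g"
  using nrm_triangle[OF assms(1) V_cmult[OF assms(2), of "-1"]] nrm_cmult[OF assms(2), of "-1"] by simp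

lemma nrm_mult_le:
  assumes "f \<in> V" "g \<in> V" "\<And>y. \<bar>f y\<bar> \<le> C" shows "nrm (\<lambda>y. f y * g y) \<le> C * nrm g"
proof -
  have C: "0 \<le> C" using assms(3) abs_ge_zero order_trans by blast
  have "(f y)\<^sup>2 \<le> C\<^sup>2" for y using assms(3)[of y] power_mono[of "\<bar>f y\<bar>" C 2] by simp
  then have "I (\<lambda>y. (f y * g y)\<^sup>2) \<le> I (\<lambda>y. C\<^sup>2 * (g y)\<^sup>2)"
    by (intro I_mono V_intros assms) (auto simp: power_mult_distrib intro!: mult_right_mono)
  also have "\<dots> = C\<^sup>2 * I (\<lambda>y. (g y)\<^sup>2)" by (intro I_cmult V_intros assms)
  finally have "sqrt (I (\<lambda>y. (f y * g y)\<^sup>2)) \<le> sqrt (C\<^sup>2 * I (\<lambda>y. (g y)\<^sup>2))" by simp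
  then show ?thesis using C by (simp add: nrm_def real_sqrt_mult)
qed

lemma nrm_shift: "f \<in> V \<Longrightarrow> nrm (\<lambda>y. f (S h y)) = nrm f"
  using I_shift[OF V_square, of f h] by (simp add: nrm_def)

lemma nrm_av_le:
  assumes "xs \<noteq> []" "\<And>x. v x \<in> V" "\<And>x. nrm (v x) \<le> B"
  shows "nrm (\<lambda>y. av xs (\<lambda>x. v x y)) \<le> B"
proof (rule nrm_leI)
  let ?w = "\<lambda>y. av xs (\<lambda>x. v x y)"
  show w: "?w \<in> V" using assms by (intro V_av)
  show "0 \<le> B" using assms(2,3) nrm_nonneg order_trans by blast
  have "I (\<lambda>y. ?w y * ?w y) = I (\<lambda>y. av xs (\<lambda>x. v x y * ?w y))" by (simp add: av_cmult_right)
  also have "\<dots> = av xs (\<lambda>x. I (\<lambda>y. v x y * ?w y))" by (intro I_av V_mult w assms)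
  also have "\<dots> \<le> B * nrm ?w"
  proof (intro av_le assms(1))
    fix x 
    have "I (\<lambda>y. v x y * ?w y) \<le> nrm (v x) * nrm ?w"
      using Cauchy_Schwarz[OF assms(2) w, of x] by linarith
    also have "\<dots> \<le> B * nrm ?w" using assms(3) nrm_nonneg[OF w] by (rule mult_right_mono)
    finally show "I (\<lambda>y. v x y * ?w y) \<le> B * nrm ?w" .
  qed
  finally show "I (\<lambda>y. ?w y * ?w y) \<le> B * nrm ?w" .
qed

text \<open>\<^term>\<open>V\<close> is only a pre-Hilbert space, so functionals are represented up to an error.\<close>

lemma approximate_Riesz:
  assumes add: "\<And>f g. f \<in> V \<Longrightarrow> g \<in> V \<Longrightarrow> l (\<lambda>y. f y + g y) = l f + l g"
    and cmult: "\<And>f c. f \<in> V \<Longrightarrow> l (\<lambda>y. c * f y) = c * l f"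
    and le: "\<And>f. f \<in> V \<Longrightarrow> \<bar>l f\<bar> \<le> C * nrm f" and "e > 0"
  obtains z where "z \<in> V" "\<And>q. q \<in> V \<Longrightarrow> \<bar>l q - I (\<lambda>y. q y * z y)\<bar> \<le> e * nrm q"
proof -
  \<comment> \<open>The variational form of the Riesz theorem: an exact representative would
    maximise \<open>J\<close>. Without completeness the supremum need not be attained, and a point
    within \<open>e\<close> squared of it is taken instead.\<close>
  define J where "J z = 2 * l z - I (\<lambda>y. (z y)\<^sup>2)" for z
  have JC: "J z \<le> C\<^sup>2" if "z \<in> V" for z
  proof -
    have "J z \<le> 2 * (C * nrm z) - (nrm z)\<^sup>2" using le[OF that] nrm_square[OF that] by (simp add: J_def)
    also have "\<dots> \<le> C\<^sup>2" using zero_le_power2[of "C - nrm z"] by (simp add: power2_eq_square algebra_simps)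
    finally show ?thesis .
  qed
  have bd: "bdd_above (J ` V)" using JC by (auto intro!: bdd_aboveI)
  have ne: "J ` V \<noteq> {}" using V_const by auto
  have "\<exists>z\<in>V. Sup (J ` V) - e\<^sup>2 < J z"
    using less_cSupD[OF ne, of "Sup (J ` V) - e\<^sup>2"] \<open>e > 0\<close> by auto
  then obtain z where z: "z \<in> V" "Sup (J ` V) - e\<^sup>2 < J z" by blast
  have "\<bar>l q - I (\<lambda>y. q y * z y)\<bar> \<le> e * nrm q" if q: "q \<in> V" for q
  proof (cases "nrm q = 0")
    case True
    then show ?thesis using le[OF q] Cauchy_Schwarz[OF q z(1)] by simp
  next
    case False
    define b where "b = l q - I (\<lambda>y. q y * z y)"
    have n: "nrm q > 0" using False nrm_nonneg[OF q] by simp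
    \<comment> \<open>Moving from \<open>z\<close> in the direction \<open>q\<close> cannot gain
      more than the remaining gap to the supremum. The optimal \<open>t\<close>, which is
      \<open>b\<close> over the squared norm of \<open>q\<close>, then bounds
      \<open>b\<close>.\<close>
    have step: "2 * t * b - t\<^sup>2 * (nrm q)\<^sup>2 \<le> e\<^sup>2" for t
    proof -
      have "J (\<lambda>y. z y + t * q y) \<le> Sup (J ` V)"
        using bd z q by (intro cSup_upper imageI V_add V_cmult) auto
      moreover have "J (\<lambda>y. z y + t * q y) = J z + 2 * t * b - t\<^sup>2 * (nrm q)\<^sup>2"
        unfolding J_def I_square_add[OF z(1) q] nrm_square[OF q]
        using add[OF z(1) V_cmult[OF q]] cmult[OF q] by (simp add: b_def algebra_simps)
      ultimately show ?thesis using z by simp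
    qed
    have "b\<^sup>2 / (nrm q)\<^sup>2 \<le> e\<^sup>2" using step[of "b / (nrm q)\<^sup>2"] n
      by (simp add: power2_eq_square field_simps)
    then have "b\<^sup>2 \<le> (e * nrm q)\<^sup>2" using n by (simp add: field_simps power_mult_distrib)
    then have "\<bar>b\<bar> \<le> \<bar>e * nrm q\<bar>" by (simp add: abs_le_square_iff)
    then show ?thesis using \<open>e > 0\<close> n by (simp add: b_def)
  qed
  with z(1) show ?thesis using that by blast
qed

end

text \<open>The base point g is averaged by \<open>m\<close>, and the fibre over it is a copy of the
  old system on which p acts through \<open>\<theta> p g\<close>. Invariance of the integral holds
  fibre by fibre, so \<open>m\<close> may be any mean. Points outside the range of
  \<open>\<iota>\<close> are invisible to the integral.\<close>

lemma fibred_mean_system: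
  fixes \<iota> :: "'g \<Rightarrow> 'y \<Rightarrow> 'z" and S' :: "'p::ab_group_add \<Rightarrow> 'z \<Rightarrow> 'z"
  assumes "mean_system V I S" "mean m"
    and S': "\<And>p g y. S' p (\<iota> g y) = \<iota> g (S (\<theta> p g) y)" "\<And>z. S' 0 z = z"
      "\<And>a b z. S' (a + b) z = S' a (S' b z)"
  shows "mean_system {F. bdd F \<and> (\<forall>g. (\<lambda>y. F (\<iota> g y)) \<in> V)} (\<lambda>F. m (\<lambda>g. I (\<lambda>y. F (\<iota> g y)))) S'"
proof -
  interpret mean_system V I S by fact
  interpret m: mean m by fact
  have b: "bdd (\<lambda>g. I (\<lambda>y. F (\<iota> g y)))" if "bdd F" "\<And>g. (\<lambda>y. F (\<iota> g y)) \<in> V" for F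
  proof -
    obtain C where "\<And>z. \<bar>F z\<bar> \<le> C" using \<open>bdd F\<close> by (auto elim!: bddE)
    then show ?thesis using that by (intro bddI[of _ C] I_abs_le) auto
  qed
  show ?thesis
  proof (unfold_locales, goal_cases)
    case (1 f) then show ?case by simp
  next
    case (2 c) then show ?case by (simp add: V_const)
  next
    case (3 f g) then show ?case by (auto intro: V_add bdd_add)
  next
    case (4 f g) then show ?case by (auto intro: V_mult bdd_mult)
  next
    case (5 f h) then show ?case using V_shift bdd_comp[of f "S' h"] by (fastforce simp: S')
  next
    case (6 f g) then show ?case by (simp add: I_add m.add b)
  next
    case (7 f c) then show ?case by (simp add: I_cmult m.cmult b)
  next
    case (8 f) then show ?case by (intro m.nonneg I_nonneg b) auto
  next
    case 9 then show ?case by simp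
  next
    case (10 f h) then show ?case by (simp add: S' I_shift[where f="\<lambda>y. f (\<iota> _ y)"])
  next
    case (11 y) then show ?case by (simp add: S')
  next
    case (12 a b y) then show ?case by (simp add: S')
  qed
qed

section \<open>Almost convergence of averages\<close>

context mean_system
begin

text \<open>A Cauchy condition up to \<open>e\<close> without Folner sequences: one finite pattern
  has nearly the same average in every position. This uniformity in the position is what later
  yields syndeticity.\<close>

definition almost_conv :: "real \<Rightarrow> ('g::ab_group_add \<Rightarrow> 'y \<Rightarrow> real) \<Rightarrow> bool" where
  "almost_conv e v \<longleftrightarrow> (\<exists>xs. xs \<noteq> [] \<and>
     (\<forall>h h'. nrm (\<lambda>y. av xs (\<lambda>g. v (g + h) y) - av xs (\<lambda>g. v (g + h') y)) \<le> e))"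

lemma almost_conv_mono: "almost_conv a v \<Longrightarrow> a \<le> b \<Longrightarrow> almost_conv b v"
  unfolding almost_conv_def by (meson order_trans)

text \<open>The convolution of the two lists serves both summands: each difference becomes an
  average of differences of translated averages over the summand's own list.\<close>

lemma almost_conv_add:
  assumes v: "\<And>g. v g \<in> V" and w: "\<And>g. w g \<in> V" and "almost_conv a v" "almost_conv b w"
  shows "almost_conv (a + b) (\<lambda>g y. v g y + w g y)"
proof -
  obtain xs where xs: "xs \<noteq> []" 
      "\<And>h h'. nrm (\<lambda>y. av xs (\<lambda>g. v (g + h) y) - av xs (\<lambda>g. v (g + h') y)) \<le> a"
    using assms(3) by (auto simp: almost_conv_def)
  obtain ys where ys: "ys \<noteq> []" 
      "\<And>h h'. nrm (\<lambda>y. av ys (\<lambda>g. w (g + h) y) - av ys (\<lambda>g. w (g + h') y)) \<le> b"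
    using assms(4) by (auto simp: almost_conv_def)
  show ?thesis unfolding almost_conv_def
  proof (intro exI[of _ "conv xs ys"] conjI allI)
    show "conv xs ys \<noteq> []" using xs ys by simp
    fix h h'
    let ?d = "\<lambda>y. av ys (\<lambda>t. av xs (\<lambda>g. v (g + (t + h)) y) - av xs (\<lambda>g. v (g + (t + h')) y))"
    let ?d' = "\<lambda>y. av xs (\<lambda>t. av ys (\<lambda>g. w (g + (t + h)) y) - av ys (\<lambda>g. w (g + (t + h')) y))"
    have "av (conv xs ys) (\<lambda>g. v (g + h) y + w (g + h) y) - av (conv xs ys) (\<lambda>g. v (g + h') y + w (g + h') y)
        = ?d y + ?d' y" for y
    proof -
      have 1: "av (conv xs ys) (\<lambda>g. v (g + k) y) = av ys (\<lambda>t. av xs (\<lambda>g. v (g + (t + k)) y))" for k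
        by (subst av_conv, subst av_swap) (simp add: add.assoc)
      have 2: "av (conv xs ys) (\<lambda>g. w (g + k) y) = av xs (\<lambda>t. av ys (\<lambda>g. w (g + (t + k)) y))" for k
        by (subst av_conv) (simp add: algebra_simps)
      show ?thesis by (simp add: av_add 1 2 av_diff)
    qed
    moreover have "nrm (\<lambda>y. ?d y + ?d' y) \<le> nrm ?d + nrm ?d'"
      by (intro nrm_triangle V_intros v w)
    moreover have "nrm ?d \<le> a" by (intro nrm_av_le ys(1) V_intros v xs(2))
    moreover have "nrm ?d' \<le> b" by (intro nrm_av_le xs(1) V_intros w ys(2))
    ultimately show "nrm (\<lambda>y. av (conv xs ys) (\<lambda>g. v (g + h) y + w (g + h) y)
        - av (conv xs ys) (\<lambda>g. v (g + h') y + w (g + h') y)) \<le> a + b" by simp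
  qed
qed

lemma almost_conv_cmult:
  assumes v: "\<And>g. v g \<in> V" and "almost_conv a v"
  shows "almost_conv (\<bar>c\<bar> * a) (\<lambda>g y. c * v g y)"
proof -
  obtain xs where xs: "xs \<noteq> []" 
      "\<And>h h'. nrm (\<lambda>y. av xs (\<lambda>g. v (g + h) y) - av xs (\<lambda>g. v (g + h') y)) \<le> a"
    using assms(2) by (auto simp: almost_conv_def)
  have "nrm (\<lambda>y. av xs (\<lambda>g. c * v (g + h) y) - av xs (\<lambda>g. c * v (g + h') y)) \<le> \<bar>c\<bar> * a" for h h'
  proof -
    have "nrm (\<lambda>y. av xs (\<lambda>g. c * v (g + h) y) - av xs (\<lambda>g. c * v (g + h') y))
        = nrm (\<lambda>y. c * (av xs (\<lambda>g. v (g + h) y) - av xs (\<lambda>g. v (g + h') y)))"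
      by (simp add: av_cmult algebra_simps)
    also have "\<dots> = \<bar>c\<bar> * nrm (\<lambda>y. av xs (\<lambda>g. v (g + h) y) - av xs (\<lambda>g. v (g + h') y))"
      by (intro nrm_cmult V_intros v)
    finally show ?thesis using xs(2)[of h h'] by (simp add: mult_left_mono)
  qed
  then show ?thesis using xs(1) by (auto simp: almost_conv_def)
qed

lemma almost_conv_if_small:
  assumes v: "\<And>g. v g \<in> V" and "xs \<noteq> []" "\<And>h. nrm (\<lambda>y. av xs (\<lambda>g. v (g + h) y)) \<le> e"
  shows "almost_conv (2 * e) v"
  unfolding almost_conv_def
proof (intro exI[of _ xs] conjI allI)
  fix h h'
  have "nrm (\<lambda>y. av xs (\<lambda>g. v (g + h) y) - av xs (\<lambda>g. v (g + h') y))
      \<le> nrm (\<lambda>y. av xs (\<lambda>g. v (g + h) y)) + nrm (\<lambda>y. av xs (\<lambda>g. v (g + h') y))"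
    by (intro nrm_triangle_diff V_intros v)
  then show "nrm (\<lambda>y. av xs (\<lambda>g. v (g + h) y) - av xs (\<lambda>g. v (g + h') y)) \<le> 2 * e"
    using assms(3)[of h] assms(3)[of h'] by simp
qed fact

lemma nrm_le_bound:
  assumes "f \<in> V" "\<And>y. \<bar>f y\<bar> \<le> C" shows "nrm f \<le> C"
  using nrm_mult_le[OF assms(1) V_const assms(2), of 1] by (simp add: nrm_def)

section \<open>Products of shifts and structured functions\<close>

definition mshift :: "(nat \<Rightarrow> 'g \<Rightarrow> 'h) \<Rightarrow> nat \<Rightarrow> (nat \<Rightarrow> 'y \<Rightarrow> real) \<Rightarrow> 'g \<Rightarrow> 'y \<Rightarrow> real" where
  "mshift \<phi> d f g y = (\<Prod>i<d. f i (S (\<phi> i g) y))"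

definition unit_fns :: "nat \<Rightarrow> (nat \<Rightarrow> 'y \<Rightarrow> real) \<Rightarrow> bool" where
  "unit_fns d f \<longleftrightarrow> (\<forall>i<d. f i \<in> V \<and> (\<forall>y. \<bar>f i y\<bar> \<le> 1))"

text \<open>The function \<open>u\<close> occupies slot \<open>d\<close>, behind arbitrary unit
  functions in the slots below. The tolerance is uniform in those functions, whereas the averaging
  list may depend on them.\<close>

definition structured :: "(nat \<Rightarrow> 'g::ab_group_add \<Rightarrow> 'h) \<Rightarrow> nat \<Rightarrow> real \<Rightarrow> ('y \<Rightarrow> real) \<Rightarrow> bool" where
  "structured \<phi> d e u \<longleftrightarrow> (\<forall>f. unit_fns d f \<longrightarrow>
     almost_conv e (\<lambda>g y. mshift \<phi> d f g y * u (S (\<phi> d g) y)))"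

lemma mshift_V: "(\<And>i. i < d \<Longrightarrow> f i \<in> V) \<Longrightarrow> mshift \<phi> d f g \<in> V"
  unfolding mshift_def[abs_def] by (intro V_prod V_shift) auto

lemma unit_mshift_V: "unit_fns d f \<Longrightarrow> mshift \<phi> d f g \<in> V"
  by (intro mshift_V) (auto simp: unit_fns_def)

lemma mshift_le: "unit_fns d f \<Longrightarrow> \<bar>mshift \<phi> d f g y\<bar> \<le> 1"
  unfolding mshift_def abs_prod by (intro prod_le_1) (auto simp: unit_fns_def)

lemma structured_mono: "structured \<phi> d a u \<Longrightarrow> a \<le> b \<Longrightarrow> structured \<phi> d b u"
  unfolding structured_def using almost_conv_mono by blast

lemma structured_add:
  assumes "u \<in> V" "v \<in> V" "structured \<phi> d a u" "structured \<phi> d b v"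
  shows "structured \<phi> d (a + b) (\<lambda>y. u y + v y)"
  unfolding structured_def
proof (intro allI impI)
  fix f assume f: "unit_fns d f"
  have "almost_conv (a + b) (\<lambda>g y. mshift \<phi> d f g y * u (S (\<phi> d g) y) + mshift \<phi> d f g y * v (S (\<phi> d g) y))"
    using assms f by (intro almost_conv_add V_mult unit_mshift_V V_shift) (auto simp: structured_def)
  then show "almost_conv (a + b) (\<lambda>g y. mshift \<phi> d f g y * (u (S (\<phi> d g) y) + v (S (\<phi> d g) y)))"
    by (simp add: distrib_left)
qed

lemma structured_cmult:
  assumes "u \<in> V" "structured \<phi> d a u"
  shows "structured \<phi> d (\<bar>c\<bar> * a) (\<lambda>y. c * u y)"
  unfolding structured_def
proof (intro allI impI)
  fix f assume f: "unit_fns d f"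
  have "almost_conv (\<bar>c\<bar> * a) (\<lambda>g y. c * (mshift \<phi> d f g y * u (S (\<phi> d g) y)))"
    using assms f by (intro almost_conv_cmult V_mult unit_mshift_V V_shift) (auto simp: structured_def)
  then show "almost_conv (\<bar>c\<bar> * a) (\<lambda>g y. mshift \<phi> d f g y * (c * u (S (\<phi> d g) y)))"
    by (simp add: mult.left_commute)
qed

lemma structured_zero: "0 \<le> e \<Longrightarrow> structured \<phi> d e (\<lambda>_. 0)"
  by (auto simp: structured_def almost_conv_def nrm_def intro: exI[of _ "[0]"])

lemma nrm_mshift_le:
  assumes "unit_fns d f" "u \<in> V" shows "nrm (\<lambda>y. mshift \<phi> d f g y * u (S a y)) \<le> nrm u"
  using nrm_mult_le[OF unit_mshift_V[OF assms(1)] V_shift[OF assms(2)] mshift_le[OF assms(1)]] 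
    nrm_shift[OF assms(2)] by simp

end

section \<open>Almost convergence of multiple averages along commuting actions\<close>

text \<open>List components serve as auxiliary parameters: the induction passes to fibred systems over
  the averaging group without leaving the type.\<close>

definition lift :: "('h \<Rightarrow> 'x \<Rightarrow> 'x) \<Rightarrow> 'h \<Rightarrow> 'g list \<times> 'x \<Rightarrow> 'g list \<times> 'x" where
  "lift S h p = (fst p, S h (snd p))"

definition push :: "'g \<Rightarrow> 'g list \<times> 'x \<Rightarrow> 'g list \<times> 'x" where
  "push g p = (g # fst p, snd p)"

text \<open>Glues a family of functions indexed by the base into one function on the fibred space.
  On the empty list it uses the value at \<open>hd []\<close>, which the fibred integral never
  sees.\<close>

definition pop :: "('g \<Rightarrow> 'g list \<times> 'x \<Rightarrow> real) \<Rightarrow> 'g list \<times> 'x \<Rightarrow> real" where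
  "pop F p = F (hd (fst p)) (tl (fst p), snd p)"

lemma lift_push: "lift S h (push g p) = push g (lift S h p)"
  by (simp add: lift_def push_def)

lemma pop_push [simp]: "pop F (push g p) = F g p"
  by (simp add: pop_def push_def)

text \<open>If the averages with \<^term>\<open>r\<close> in the last slot stay large, then \<^term>\<open>r\<close> correlates with
  the limit of the dual functions of these averages. Translating the averaging variable shows that
  the orbit of such a limit is an average of products of \<^term>\<open>d\<close> shifts, so that the induction
  hypothesis, applied to a fibred system, yields uniform almost convergence.\<close>

lemma ex_structured_correlate:
  fixes \<phi> :: "nat \<Rightarrow> 'g::ab_group_add \<Rightarrow> 'h::ab_group_add"
    and V :: "('g list \<times> 'x \<Rightarrow> real) set" and S0 :: "'h \<Rightarrow> 'x \<Rightarrow> 'x"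
  defines "S \<equiv> lift S0"
  assumes sys: "mean_system V I S" and hom: "\<And>i a b. \<phi> i (a + b) = \<phi> i a + \<phi> i b"
    and IH: "\<And>(V' :: ('g list \<times> 'x \<Rightarrow> real) set) I' f e. mean_system V' I' S \<Longrightarrow> (\<And>i. i < d \<Longrightarrow> f i \<in> V') \<Longrightarrow> e > 0 \<Longrightarrow>
      mean_system.almost_conv I' e (mean_system.mshift S \<phi> d f)"
    and r: "r \<in> V" and f: "mean_system.unit_fns V d f" and "\<eta> > 0" "e > 0"
    and big: "\<And>xs. xs \<noteq> [] \<Longrightarrow> \<exists>h. mean_system.nrm I (\<lambda>y. av xs (\<lambda>g.
        mean_system.mshift S \<phi> d f (g + h) y * r (S (\<phi> d (g + h)) y))) > \<eta>"
  shows "\<exists>z\<in>V. mean_system.structured V I S \<phi> d e z \<and> \<eta>\<^sup>2 - e * mean_system.nrm I r \<le> I (\<lambda>y. r y * z y)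
     \<and> mean_system.nrm I z \<le> mean_system.nrm I r + e"
proof -
  interpret mean_system V I S by fact
  have S_push: "S h (push g y) = push g (S h y)" for h g y
    by (simp add: S_def lift_push)
  define Q where "Q q g y = mshift \<phi> d f g y * q (S (\<phi> d g) y)" for q g y
  have QV: "Q q g \<in> V" if "q \<in> V" for q g
    unfolding Q_def[abs_def] by (intro V_mult unit_mshift_V f V_shift that)
  have Qn: "nrm (Q q g) \<le> nrm q" if "q \<in> V" for q g
    unfolding Q_def[abs_def] by (intro nrm_mshift_le f that)
  obtain B where B: "B > 0" "\<And>y. \<bar>r y\<bar> \<le> B" using V_bdd[OF r] by (auto elim!: bddE)

  obtain xs0 :: "('g \<times> nat) set \<Rightarrow> 'g list" where xs0: "\<And>E. xs0 E \<noteq> []"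
    "\<And>E g n a. finite E \<Longrightarrow> (g, n) \<in> E \<Longrightarrow> (\<forall>x. \<bar>a x\<bar> \<le> 1) \<Longrightarrow>
      \<bar>av (xs0 E) (\<lambda>x. a (x + g)) - av (xs0 E) a\<bar> \<le> 1 / real (Suc n)"
    using ex_asymp_invariant_family by blast
  \<comment> \<open>By \<open>big\<close>, every almost invariant list has a translate with a large
    average. Translation keeps the almost invariance, so the lists \<open>ys\<close> have both
    properties.\<close>
  have "\<forall>E. \<exists>h. \<eta> < nrm (\<lambda>y. av (xs0 E) (\<lambda>g. Q r (g + h) y))"
    using big[OF xs0(1)] unfolding Q_def by blast
  from choice[OF this] obtain sh where sh: "\<And>E. \<eta> < nrm (\<lambda>y. av (xs0 E) (\<lambda>g. Q r (g + sh E) y))"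
    by blast
  define ys where "ys E = map (\<lambda>g. g + sh E) (xs0 E)" for E
  have ys0: "ys E \<noteq> []" for E using xs0 by (simp add: ys_def)
  have ysinv: "\<bar>av (ys E) (\<lambda>x. a (x + g)) - av (ys E) a\<bar> \<le> 1 / real (Suc n)"
    if "finite E" "(g, n) \<in> E" "\<forall>x. \<bar>a x\<bar> \<le> 1" for E g n a
    using xs0(2)[OF that(1,2), of "\<lambda>x. a (x + sh E)"] that(3) by (simp add: ys_def av_map add_ac)
  obtain L where L: "mean L" and Linv: "\<And>a g C. (\<And>E x. \<bar>a E x\<bar> \<le> C) \<Longrightarrow>
           L (\<lambda>E. av (ys E) (\<lambda>x. a E (x + g))) = L (\<lambda>E. av (ys E) (a E))"
    using ex_limit_along_invariant_lists[of ys, OF ysinv ys0] by blast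
  interpret L: mean L by fact
  define m where "m a = L (\<lambda>E. av (ys E) a)" for a
  have "mean m" unfolding m_def[abs_def] using L ys0 by (rule mean_of_averages)
  interpret m: mean m by fact

  define w where "w E y = av (ys E) (\<lambda>g. Q r g y)" for E y
  have wV: "w E \<in> V" for E unfolding w_def[abs_def] by (intro V_av QV r)
  have w_big: "\<eta> < nrm (w E)" for E using sh[of E] by (simp add: w_def[abs_def] ys_def av_map)
  have w_le: "nrm (w E) \<le> nrm r" for E
    unfolding w_def[abs_def] by (intro nrm_av_le ys0 QV Qn r)
  have wB: "\<bar>w E y\<bar> \<le> B" for E y
    unfolding w_def Q_def
  proof (intro av_abs_le ys0)
    fix g show "\<bar>mshift \<phi> d f g y * r (S (\<phi> d g) y)\<bar> \<le> B"
      using mult_mono[OF mshift_le[OF f, of \<phi> g y] B(2)[of "S (\<phi> d g) y"]] by (simp add: abs_mult)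
  qed

  \<comment> \<open>Pairs the average with \<open>r\<close> in the last slot against the one with
    \<open>q\<close> there. At \<open>q = r\<close> this is the squared norm of \<open>w E\<close>,
    hence at least \<open>\<eta>\<close> squared; the limit functional \<open>l\<close> stands in
    for the limit of the dual functions.\<close>
  define lE where "lE E q = I (\<lambda>y. w E y * av (ys E) (\<lambda>g. Q q g y))" for E q
  define l where "l q = L (\<lambda>E. lE E q)" for q
  have lE_le: "\<bar>lE E q\<bar> \<le> nrm r * nrm q" if q: "q \<in> V" for E q
  proof -
    have "\<bar>lE E q\<bar> \<le> nrm (w E) * nrm (\<lambda>y. av (ys E) (\<lambda>g. Q q g y))"
      unfolding lE_def by (intro Cauchy_Schwarz wV V_av QV q)
    also have "\<dots> \<le> nrm r * nrm q"
      by (intro mult_mono w_le nrm_av_le ys0 QV Qn q nrm_nonneg V_av r)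
    finally show ?thesis .
  qed
  have lE_bdd: "bdd (\<lambda>E. lE E q)" if "q \<in> V" for q using lE_le[OF that] by (rule bddI)
  have l_add: "l (\<lambda>y. p y + q y) = l p + l q" if "p \<in> V" "q \<in> V" for p q
  proof -
    have "lE E (\<lambda>y. p y + q y) = lE E p + lE E q" for E
    proof -
      have "lE E (\<lambda>y. p y + q y) = I (\<lambda>y. w E y * av (ys E) (\<lambda>g. Q p g y) + w E y * av (ys E) (\<lambda>g. Q q g y))"
        by (simp add: lE_def Q_def distrib_left av_add)
      also have "\<dots> = lE E p + lE E q" unfolding lE_def by (intro I_add V_mult wV V_av QV that)
      finally show ?thesis .
    qed
    then show ?thesis by (simp add: l_def L.add lE_bdd that)
  qed
  have l_cmult: "l (\<lambda>y. c * q y) = c * l q" if "q \<in> V" for c q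
  proof -
    have "lE E (\<lambda>y. c * q y) = c * lE E q" for E
    proof -
      have "lE E (\<lambda>y. c * q y) = I (\<lambda>y. c * (w E y * av (ys E) (\<lambda>g. Q q g y)))"
        by (simp add: lE_def Q_def mult.left_commute av_cmult)
      also have "\<dots> = c * lE E q" unfolding lE_def by (intro I_cmult V_mult wV V_av QV that)
      finally show ?thesis .
    qed
    then show ?thesis by (simp add: l_def L.cmult lE_bdd that)
  qed
  have l_le: "\<bar>l q\<bar> \<le> nrm r * nrm q" if "q \<in> V" for q
    unfolding l_def using lE_le[OF that] by (rule L.abs_le)
  have l_r: "\<eta>\<^sup>2 \<le> l r"
    unfolding l_def
  proof (intro L.ge lE_bdd r)
    fix E
    have "lE E r = (nrm (w E))\<^sup>2"
      by (simp add: lE_def nrm_square[OF wV]) (simp add: w_def power2_eq_square)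
    then show "\<eta>\<^sup>2 \<le> lE E r" using w_big[of E] \<open>\<eta> > 0\<close> by simp
  qed

  \<comment> \<open>Two averages are compared below, and each replaces \<open>z\<close> by
    \<open>l\<close> once. This uses up e / 2 and leaves e / 2 for the main term.\<close>
  have "e / 4 > 0" using \<open>e > 0\<close> by simp
  obtain z where z: "z \<in> V" "\<And>q. q \<in> V \<Longrightarrow> \<bar>l q - I (\<lambda>y. q y * z y)\<bar> \<le> e / 4 * nrm q"
    using approximate_Riesz[of l "nrm r" "e / 4", OF l_add l_cmult l_le \<open>e / 4 > 0\<close>] by blast

  have "structured \<phi> d e z"
    unfolding structured_def
  proof (intro allI impI)
    fix p assume p: "unit_fns d p"
    \<comment> \<open>After the averaging variable g is replaced by g + g' and everything is shifted
      by \<open>- \<phi> d g\<close>, the variable g' enters only through the first \<open>d\<close>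
      actions, applied to these functions. The last action survives only in the parameter g.\<close>
    define G where "G g i y = p i y * f i (S (\<phi> i g - \<phi> d g) y)" for g i y
    have G: "unit_fns d (G g)" for g
      unfolding unit_fns_def
    proof (intro allI impI conjI)
      fix i y assume "i < d"
      then have pf: "p i \<in> V" "f i \<in> V" "\<And>y. \<bar>p i y\<bar> \<le> 1" "\<And>y. \<bar>f i y\<bar> \<le> 1"
        using p f unfolding unit_fns_def by blast+
      show "G g i \<in> V" unfolding G_def[abs_def] by (intro V_mult V_shift pf)
      show "\<bar>G g i y\<bar> \<le> 1" unfolding G_def abs_mult by (intro mult_le_one pf abs_ge_zero)
    qed
    \<comment> \<open>The parameter g becomes the head of the list, so the induction hypothesis for
      the system fibred over the group with mean \<open>m\<close> gives one list \<open>xs\<close>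
      that is good for most g at once.\<close>
    define F where "F i = pop (\<lambda>g. G g i)" for i
    have F_push: "mshift \<phi> d F g' (push g y) = mshift \<phi> d (G g) g' y" for g g' y
      by (simp add: mshift_def S_push F_def)
    let ?V = "{F. bdd F \<and> (\<forall>g. (\<lambda>y. F (push g y)) \<in> V)}"
    let ?I = "\<lambda>F. m (\<lambda>g. I (\<lambda>y. F (push g y)))"
    have sys': "mean_system ?V ?I S"
      using sys \<open>mean m\<close> by (rule fibred_mean_system) (simp_all add: S_push S_0 S_add)
    have "F i \<in> ?V" if "i < d" for i
    proof -
      have "bdd (F i)" using G that unfolding F_def pop_def unit_fns_def by (intro bddI[of _ 1]) blast
      then show ?thesis using G that by (auto simp: F_def unit_fns_def)
    qed
    \<comment> \<open>The factor B in the denominator pays for the sup bound of \<open>w E\<close>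
      when Cauchy-Schwarz is applied to the main term.\<close>
    moreover have e4: "e / (2 * B) > 0" using \<open>e > 0\<close> B by simp
    ultimately have "mean_system.almost_conv ?I (e / (2 * B)) (mshift \<phi> d F)"
      using sys' by (intro IH) auto
    then obtain xs where xs: "xs \<noteq> []" "\<And>h h'. mean_system.nrm ?I 
        (\<lambda>y. av xs (\<lambda>g. mshift \<phi> d F (g + h) y) - av xs (\<lambda>g. mshift \<phi> d F (g + h') y)) \<le> e / (2 * B)"
      unfolding mean_system.almost_conv_def[OF sys'] by blast
    have "nrm (\<lambda>y. av xs (\<lambda>g. mshift \<phi> d p (g + h) y * z (S (\<phi> d (g + h)) y))
               - av xs (\<lambda>g. mshift \<phi> d p (g + h') y * z (S (\<phi> d (g + h')) y))) \<le> e" for h h'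
    proof -
      let ?A = "\<lambda>h y. av xs (\<lambda>g. mshift \<phi> d p (g + h) y * z (S (\<phi> d (g + h)) y))"
      define D where "D g y = av xs (\<lambda>g'. mshift \<phi> d (G g) (g' + h) y) 
          - av xs (\<lambda>g'. mshift \<phi> d (G g) (g' + h') y)" for g y
      have DV: "D g \<in> V" for g
        unfolding D_def[abs_def] by (intro V_diff V_av unit_mshift_V G)
      have D2: "\<bar>D g y\<bar> \<le> 2" for g y
      proof -
        have "\<bar>av xs (\<lambda>g'. mshift \<phi> d (G g) (g' + k) y)\<bar> \<le> 1" for k
          by (intro av_abs_le xs(1) mshift_le G)
        from this[of h] this[of h'] show ?thesis unfolding D_def by linarith
      qed
      have nD_bdd: "bdd (\<lambda>g. nrm (D g))"
        using nrm_le_bound[OF DV D2] nrm_nonneg[OF DV] by (intro bddI[of _ 2]) simp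
      \<comment> \<open>The norm in the fibred system is quadratic in g; Jensen's inequality for
        \<open>m\<close> makes the bound linear in \<open>nrm (D g)\<close>.\<close>
      have mD: "m (\<lambda>g. nrm (D g)) \<le> e / (2 * B)"
      proof -
        have "(m (\<lambda>g. nrm (D g)))\<^sup>2 \<le> m (\<lambda>g. (nrm (D g))\<^sup>2)" by (intro m.square_ge nD_bdd)
        also have "\<dots> = ?I (\<lambda>y. (av xs (\<lambda>g. mshift \<phi> d F (g + h) y) - av xs (\<lambda>g. mshift \<phi> d F (g + h') y))\<^sup>2)"
          by (simp add: F_push nrm_square[OF DV]) (simp add: D_def)
        finally have "sqrt ((m (\<lambda>g. nrm (D g)))\<^sup>2) \<le> e / (2 * B)"
          using xs(2)[of h h'] unfolding mean_system.nrm_def[OF sys'] by (meson order_trans real_sqrt_le_mono)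
        then show ?thesis by simp
      qed
      have test: "I (\<lambda>y. q y * (?A h y - ?A h' y)) \<le> e * nrm q" if q: "q \<in> V" for q
      proof -
        obtain Bq where Bq: "Bq > 0" "\<And>y. \<bar>q y\<bar> \<le> Bq" using V_bdd[OF q] by (auto elim!: bddE)
        \<comment> \<open>The shift on \<open>z\<close> is moved to the test function: the pairing
          of \<open>q\<close> with the g'-term of the structured average is the pairing of
          \<open>\<kappa> g'\<close> with \<open>z\<close>, hence close to
          \<open>l (\<kappa> g')\<close>.\<close>
        define \<kappa> where "\<kappa> g' y = q (S (- \<phi> d g') y) * mshift \<phi> d p g' (S (- \<phi> d g') y)" for g' y
        have qmV: "(\<lambda>y. q y * mshift \<phi> d p g' y) \<in> V" for g' by (intro V_mult q unit_mshift_V p)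
        have \<kappa>V: "\<kappa> g' \<in> V" for g'
          using V_shift[OF qmV] by (simp add: \<kappa>_def[abs_def])
        have \<kappa>n: "nrm (\<kappa> g') \<le> nrm q" for g'
        proof -
          have "nrm (\<kappa> g') = nrm (\<lambda>y. mshift \<phi> d p g' y * q (S 0 y))"
            using nrm_shift[OF qmV, of "- \<phi> d g'" g'] by (simp add: \<kappa>_def[abs_def] S_0 mult.commute)
          then show ?thesis using nrm_mshift_le[OF p q] by simp
        qed
        have \<kappa>B: "\<bar>\<kappa> g' y\<bar> \<le> Bq" for g' y
          using mult_mono[OF Bq(2) mshift_le[OF p, of \<phi> g'], of "S (- \<phi> d g') y" "S (- \<phi> d g') y"] Bq(1)
          by (simp add: \<kappa>_def abs_mult)
        define W where "W E g y = q y * w E (S (- \<phi> d g) y)" for E g y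
        have WV: "W E g \<in> V" for E g unfolding W_def[abs_def] by (intro V_mult q V_shift wV)
        \<comment> \<open>Invariance of the limit lets g be replaced by g + g', and invariance of
          \<open>I\<close> allows the shift by \<open>- \<phi> d g\<close>. The weight
          \<open>W E g\<close> does not depend on g', so an average over g' falls on the product of
          \<open>d\<close> shifts alone.\<close>
        have l\<kappa>: "l (\<kappa> g') = L (\<lambda>E. av (ys E) (\<lambda>g. I (\<lambda>y. W E g y * mshift \<phi> d (G g) g' y)))" for g'
        proof -
          define a where "a E g = I (\<lambda>y. w E y * Q (\<kappa> g') g y)" for E g
          have "l (\<kappa> g') = L (\<lambda>E. av (ys E) (a E))"
            unfolding l_def lE_def a_def av_cmult[symmetric] by (subst I_av) (auto intro!: V_mult wV QV \<kappa>V)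
          also have "\<dots> = L (\<lambda>E. av (ys E) (\<lambda>g. a E (g + g')))"
          proof (rule Linv[symmetric])
            fix E g
            show "\<bar>a E g\<bar> \<le> B * Bq" unfolding a_def
            proof (rule I_abs_le)
              show "(\<lambda>y. w E y * Q (\<kappa> g') g y) \<in> V" by (intro V_mult wV QV \<kappa>V)
              fix y
              have "\<bar>Q (\<kappa> g') g y\<bar> \<le> 1 * Bq" unfolding Q_def abs_mult
                using Bq(1) by (intro mult_mono mshift_le f \<kappa>B) auto
              then show "\<bar>w E y * Q (\<kappa> g') g y\<bar> \<le> B * Bq" unfolding abs_mult
                using B(1) by (intro mult_mono wB) auto
            qed
          qed
          finally have l_eq: "l (\<kappa> g') = L (\<lambda>E. av (ys E) (\<lambda>g. a E (g + g')))" .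
          have "a E (g + g') = I (\<lambda>y. W E g y * mshift \<phi> d (G g) g' y)" for E g
          proof -
            have "a E (g + g') = I (\<lambda>y. w E (S (- \<phi> d g) y) * Q (\<kappa> g') (g + g') (S (- \<phi> d g) y))"
              unfolding a_def by (rule I_shift[symmetric]) (intro V_mult wV QV \<kappa>V)
            also have "(\<lambda>y. w E (S (- \<phi> d g) y) * Q (\<kappa> g') (g + g') (S (- \<phi> d g) y))
                = (\<lambda>y. W E g y * mshift \<phi> d (G g) g' y)"
            proof
              fix y
              have 1: "\<kappa> g' (S (\<phi> d (g + g')) (S (- \<phi> d g) y)) = q y * mshift \<phi> d p g' y"
                by (simp add: \<kappa>_def hom S_0 flip: S_add)
              have 2: "mshift \<phi> d f (g + g') (S (- \<phi> d g) y) * mshift \<phi> d p g' y = mshift \<phi> d (G g) g' y"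
                unfolding mshift_def prod.distrib[symmetric] G_def
                by (intro prod.cong) (auto simp: hom algebra_simps simp flip: S_add)
              show "w E (S (- \<phi> d g) y) * Q (\<kappa> g') (g + g') (S (- \<phi> d g) y) = W E g y * mshift \<phi> d (G g) g' y"
                unfolding Q_def 1 W_def 2[symmetric] by simp
            qed
            finally show ?thesis .
          qed
          then show ?thesis by (simp add: l_eq)
        qed
        have Wb: "bdd (\<lambda>E. av (ys E) (\<lambda>g. I (\<lambda>y. W E g y * R g y)))" 
          if R: "\<And>g. R g \<in> V" "\<And>g y. \<bar>R g y\<bar> \<le> c" "c \<ge> 0" for R c
        proof (intro bddI[of _ "Bq * B * c"] av_abs_le ys0 I_abs_le V_mult WV R)
          fix E g y
          show "\<bar>W E g y * R g y\<bar> \<le> Bq * B * c"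
            unfolding W_def abs_mult using Bq(1) B(1) R(3) by (intro mult_mono Bq wB R) auto
        qed
        have avl: "av xs (\<lambda>g'. l (\<kappa> (g' + k)))
            = L (\<lambda>E. av (ys E) (\<lambda>g. I (\<lambda>y. W E g y * av xs (\<lambda>g'. mshift \<phi> d (G g) (g' + k) y))))" for k
        proof -
          have "av xs (\<lambda>g'. l (\<kappa> (g' + k)))
            = L (\<lambda>E. av xs (\<lambda>g'. av (ys E) (\<lambda>g. I (\<lambda>y. W E g y * mshift \<phi> d (G g) (g' + k) y))))"
            unfolding l\<kappa> by (intro L.average[THEN conjunct1, symmetric] Wb[of _ 1] unit_mshift_V G mshift_le) auto
          also have "\<dots> = L (\<lambda>E. av (ys E) (\<lambda>g. I (\<lambda>y. W E g y * av xs (\<lambda>g'. mshift \<phi> d (G g) (g' + k) y))))"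
            unfolding av_cmult[symmetric]
            by (subst av_swap, subst I_av) (auto intro!: V_mult WV unit_mshift_V G)
          finally show ?thesis .
        qed
        have "av xs (\<lambda>g'. l (\<kappa> (g' + h))) - av xs (\<lambda>g'. l (\<kappa> (g' + h')))
            = L (\<lambda>E. av (ys E) (\<lambda>g. I (\<lambda>y. W E g y * D g y)))"
        proof -
          have bb: "bdd (\<lambda>E. av (ys E) (\<lambda>g. I (\<lambda>y. W E g y * av xs (\<lambda>g'. mshift \<phi> d (G g) (g' + k) y))))" for k
            by (intro Wb[of _ 1] V_av unit_mshift_V G av_abs_le xs(1) mshift_le) auto
          show ?thesis
            unfolding avl L.diff[OF bb bb, symmetric] D_def right_diff_distrib
            by (subst I_diff) (auto simp: av_diff intro!: V_mult WV V_av unit_mshift_V G)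
        qed
        also have "\<dots> \<le> L (\<lambda>E. av (ys E) (\<lambda>g. nrm q * B * nrm (D g)))"
        proof (intro L.mono Wb[of _ 2] DV D2 av_mono)
          show "bdd (\<lambda>E. av (ys E) (\<lambda>g. nrm q * B * nrm (D g)))"
            using bdd_av[OF bdd_mult[OF bdd_const nD_bdd], of ys "nrm q * B" "\<lambda>_ x. x"] ys0 by simp
          fix E g
          have "I (\<lambda>y. W E g y * D g y) = I (\<lambda>y. q y * (w E (S (- \<phi> d g) y) * D g y))"
            by (simp add: W_def mult.assoc)
          also have "\<dots> \<le> nrm q * nrm (\<lambda>y. w E (S (- \<phi> d g) y) * D g y)"
            using Cauchy_Schwarz[OF q V_mult[OF V_shift[OF wV] DV]] by (meson abs_le_D1)
          also have "\<dots> \<le> nrm q * (B * nrm (D g))"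
            by (intro mult_left_mono nrm_mult_le V_shift wV DV wB nrm_nonneg q)
          finally show "I (\<lambda>y. W E g y * D g y) \<le> nrm q * B * nrm (D g)" by simp
        qed simp
        also have "\<dots> = nrm q * B * m (\<lambda>g. nrm (D g))"
        proof -
          have "bdd (\<lambda>E. av (ys E) (\<lambda>g. nrm (D g)))" using bdd_av[OF nD_bdd, of ys "\<lambda>_ x. x"] ys0 by simp
          then show ?thesis by (simp add: av_cmult L.cmult m_def)
        qed
        also have "\<dots> \<le> nrm q * B * (e / (2 * B))"
          using mD B(1) nrm_nonneg[OF q] by (intro mult_left_mono) auto
        also have "\<dots> = e / 2 * nrm q" using B(1) by simp
        finally have main: "av xs (\<lambda>g'. l (\<kappa> (g' + h))) - av xs (\<lambda>g'. l (\<kappa> (g' + h'))) \<le> e / 2 * nrm q" .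
        have AV: "?A k \<in> V" for k by (intro V_av V_mult unit_mshift_V p V_shift z(1))
        have Aq: "\<bar>I (\<lambda>y. q y * ?A k y) - av xs (\<lambda>g'. l (\<kappa> (g' + k)))\<bar> \<le> e / 4 * nrm q" for k
        proof -
          have "I (\<lambda>y. q y * ?A k y) = av xs (\<lambda>g. I (\<lambda>y. q y * (mshift \<phi> d p (g + k) y * z (S (\<phi> d (g + k)) y))))"
            unfolding av_cmult[symmetric] by (intro I_av V_mult unit_mshift_V p V_shift z(1) q)
          also have "\<dots> = av xs (\<lambda>g. I (\<lambda>y. \<kappa> (g + k) y * z y))"
          proof (rule av_cong)
            fix g
            have "I (\<lambda>y. q y * (mshift \<phi> d p (g + k) y * z (S (\<phi> d (g + k)) y)))
                = I (\<lambda>y. z (S (\<phi> d (g + k)) y) * (q y * mshift \<phi> d p (g + k) y))"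
              by (simp add: mult_ac)
            also have "\<dots> = I (\<lambda>y. \<kappa> (g + k) y * z y)"
              by (subst I_unshift[OF z(1) qmV]) (simp add: \<kappa>_def mult_ac)
            finally show "I (\<lambda>y. q y * (mshift \<phi> d p (g + k) y * z (S (\<phi> d (g + k)) y)))
                = I (\<lambda>y. \<kappa> (g + k) y * z y)" .
          qed
          finally have eq: "I (\<lambda>y. q y * ?A k y) - av xs (\<lambda>g'. l (\<kappa> (g' + k)))
              = av xs (\<lambda>g. I (\<lambda>y. \<kappa> (g + k) y * z y) - l (\<kappa> (g + k)))"
            by (simp add: av_diff)
          have le: "\<bar>I (\<lambda>y. \<kappa> g y * z y) - l (\<kappa> g)\<bar> \<le> e / 4 * nrm q" for g
            using z(2)[OF \<kappa>V[of g]] mult_left_mono[OF \<kappa>n[of g], of "e / 4"] \<open>e / 4 > 0\<close>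
            by linarith
          show ?thesis unfolding eq by (intro av_abs_le xs(1) le)
        qed
        have "I (\<lambda>y. q y * (?A h y - ?A h' y)) = I (\<lambda>y. q y * ?A h y) - I (\<lambda>y. q y * ?A h' y)"
          unfolding right_diff_distrib by (intro I_diff V_mult q AV)
        then show ?thesis using Aq[of h] Aq[of h'] main by linarith
      qed
      show ?thesis
      proof (rule nrm_leI)
        show V: "(\<lambda>y. ?A h y - ?A h' y) \<in> V" by (intro V_diff V_av V_mult unit_mshift_V p V_shift z(1))
        show "0 \<le> e" using \<open>e > 0\<close> by simp
        show "I (\<lambda>y. (?A h y - ?A h' y) * (?A h y - ?A h' y)) \<le> e * nrm (\<lambda>y. ?A h y - ?A h' y)"
          using test[OF V] .
      qed
    qed
    then show "almost_conv e (\<lambda>g y. mshift \<phi> d p g y * z (S (\<phi> d g) y))"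
      unfolding almost_conv_def using xs(1) by blast
  qed
  moreover have "\<eta>\<^sup>2 - e * nrm r \<le> I (\<lambda>y. r y * z y)"
    using z(2)[OF r] l_r mult_right_mono[of "e / 4" e "nrm r"] nrm_nonneg[OF r] \<open>e > 0\<close>
    unfolding abs_le_iff by linarith
  moreover have "nrm z \<le> nrm r + e"
  proof (rule nrm_leI[OF z(1)])
    show "0 \<le> nrm r + e" using nrm_nonneg[OF r] \<open>e > 0\<close> by simp
    have "I (\<lambda>y. z y * z y) \<le> nrm r * nrm z + e / 4 * nrm z"
      using z(2)[OF z(1)] l_le[OF z(1)] unfolding abs_le_iff by linarith
    also have "\<dots> \<le> nrm r * nrm z + e * nrm z"
      using nrm_nonneg[OF z(1)] \<open>e > 0\<close> by (intro add_left_mono mult_right_mono) auto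
    finally show "I (\<lambda>y. z y * z y) \<le> (nrm r + e) * nrm z" by (simp add: distrib_right)
  qed
  ultimately show ?thesis using z(1) by blast
qed

text \<open>Energy decrement. While the remainder of \<open>u\<close> is unstructured, some
  structured function correlates with it, and subtracting a multiple of that function lowers the
  squared norm by a fixed amount. This cannot go on forever.\<close>

lemma all_structured:
  fixes \<phi> :: "nat \<Rightarrow> 'g::ab_group_add \<Rightarrow> 'h::ab_group_add"
    and V :: "('g list \<times> 'x \<Rightarrow> real) set" and S0 :: "'h \<Rightarrow> 'x \<Rightarrow> 'x"
  defines "S \<equiv> lift S0"
  assumes sys: "mean_system V I S" and hom: "\<And>i a b. \<phi> i (a + b) = \<phi> i a + \<phi> i b"
    and IH: "\<And>(V' :: ('g list \<times> 'x \<Rightarrow> real) set) I' f e. mean_system V' I' S \<Longrightarrow> (\<And>i. i < d \<Longrightarrow> f i \<in> V') \<Longrightarrow> e > 0 \<Longrightarrow>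
      mean_system.almost_conv I' e (mean_system.mshift S \<phi> d f)"
    and u: "u \<in> V" and "e > 0"
  shows "mean_system.structured V I S \<phi> d e u"
proof (rule ccontr)
  interpret mean_system V I S by fact
  assume not: "\<not> structured \<phi> d e u"
  \<comment> \<open>The remainder fails to be structured at e / 2, which is
    \<open>2 * \<eta>\<close>; by \<open>almost_conv_if_small\<close>, every list then has a
    translated average of norm above \<open>\<eta>\<close>.\<close>
  define \<eta> where "\<eta> = e / 4"
  define C where "C = nrm u + 1"
  \<comment> \<open>Subtracting \<open>t\<close> times the correlating function gains at least
    \<open>t * \<eta>\<^sup>2\<close> in the cross term and loses at most half of that in the
    quadratic term.\<close>
  define t where "t = (\<eta>\<^sup>2 / 2) / C\<^sup>2"
  have pos: "\<eta> > 0" "C > 0" "t > 0"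
    using \<open>e > 0\<close> nrm_nonneg[OF u] by (auto simp: \<eta>_def C_def t_def add_nonneg_pos)
  have tC: "t * C\<^sup>2 = \<eta>\<^sup>2 / 2" using pos by (simp add: t_def)
  \<comment> \<open>The tolerance is quantified inside the induction, since each step calls the
    previous one with at most half of it. Keeping it below e / 2 there ensures that the remainder is
    unstructured at e / 2.\<close>
  have descent: "\<forall>e0>0. \<exists>s\<in>V. structured \<phi> d e0 s \<and>
      I (\<lambda>y. (u y - s y)\<^sup>2) \<le> I (\<lambda>y. (u y)\<^sup>2) - real n * (t * \<eta>\<^sup>2 / 2)" for n
  proof (induction n)
    case 0
    show ?case by (intro allI impI bexI[of _ "\<lambda>_. 0"] V_const) (auto intro: structured_zero)
  next
    case (Suc n)
    show ?case
    proof (intro allI impI)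
      fix e0 :: real assume "e0 > 0"
      define e1 where "e1 = min (e0 / 2) (e / 2)"
      have "e1 > 0" using \<open>e > 0\<close> \<open>e0 > 0\<close> by (simp add: e1_def)
      then obtain s where s: "s \<in> V" "structured \<phi> d e1 s"
        "I (\<lambda>y. (u y - s y)\<^sup>2) \<le> I (\<lambda>y. (u y)\<^sup>2) - real n * (t * \<eta>\<^sup>2 / 2)"
        using Suc.IH by blast
      define r where "r y = u y - s y" for y
      have rV: "r \<in> V" unfolding r_def[abs_def] by (intro V_diff u s)
      have "I (\<lambda>y. (r y)\<^sup>2) \<le> I (\<lambda>y. (u y)\<^sup>2)"
      proof -
        have "0 \<le> real n * (t * \<eta>\<^sup>2 / 2)" using pos by simp
        then show ?thesis using s(3) unfolding r_def by linarith
      qed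
      then have r_le: "nrm r \<le> nrm u" by (simp add: nrm_def)
      have "\<not> structured \<phi> d (e / 2) r"
      proof
        assume "structured \<phi> d (e / 2) r"
        then have "structured \<phi> d (e1 + e / 2) (\<lambda>y. s y + r y)" by (intro structured_add s rV)
        then have "structured \<phi> d e (\<lambda>y. s y + r y)" by (rule structured_mono) (simp add: e1_def)
        then show False using not by (simp add: r_def)
      qed
      then obtain f where f: "unit_fns d f" 
        and nf: "\<not> almost_conv (2 * \<eta>) (\<lambda>g y. mshift \<phi> d f g y * r (S (\<phi> d g) y))"
        by (auto simp: structured_def \<eta>_def)
      have big: "\<exists>h. \<eta> < nrm (\<lambda>y. av xs (\<lambda>g. mshift \<phi> d f (g + h) y * r (S (\<phi> d (g + h)) y)))"
        if "xs \<noteq> []" for xs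
      proof (rule ccontr)
        assume "\<not> ?thesis"
        then have "nrm (\<lambda>y. av xs (\<lambda>g. mshift \<phi> d f (g + h) y * r (S (\<phi> d (g + h)) y))) \<le> \<eta>" for h
          by (simp add: not_less)
        then have "almost_conv (2 * \<eta>) (\<lambda>g y. mshift \<phi> d f g y * r (S (\<phi> d g) y))"
          by (intro almost_conv_if_small[OF _ that] V_mult unit_mshift_V f V_shift rV)
        with nf show False by contradiction
      qed
      \<comment> \<open>The three bounds keep the norm of \<open>z\<close> below \<open>C\<close>,
        the structure error \<open>t * e2\<close> below e0 / 2, and the loss in the correlation
        below half of \<open>\<eta>\<close> squared.\<close>
      define e2 where "e2 = min 1 (min (e0 / (2 * t)) (\<eta>\<^sup>2 / (2 * C)))"
      have "e2 > 0" using \<open>e0 > 0\<close> pos by (simp add: e2_def)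
      obtain z where z: "z \<in> V" "structured \<phi> d e2 z" "\<eta>\<^sup>2 - e2 * nrm r \<le> I (\<lambda>y. r y * z y)"
        "nrm z \<le> nrm r + e2"
      proof -
        have "\<exists>z\<in>V. structured \<phi> d e2 z \<and> \<eta>\<^sup>2 - e2 * nrm r \<le> I (\<lambda>y. r y * z y) \<and> nrm z \<le> nrm r + e2"
          by (rule ex_structured_correlate[where ?S0.0 = S0 and \<phi> = \<phi>, folded S_def])
             (fact sys hom IH rV f pos(1) \<open>e2 > 0\<close> big)+
        then show ?thesis using that by blast
      qed
      have "e2 * nrm r \<le> (\<eta>\<^sup>2 / (2 * C)) * C"
        using r_le pos nrm_nonneg[OF rV] by (intro mult_mono) (auto simp: e2_def C_def)
      then have rz: "\<eta>\<^sup>2 / 2 \<le> I (\<lambda>y. r y * z y)" using z(3) pos by simp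
      have "nrm z \<le> C" using z(4) r_le by (simp add: C_def e2_def)
      then have zz: "I (\<lambda>y. (z y)\<^sup>2) \<le> C\<^sup>2"
        using nrm_square[OF z(1)] nrm_nonneg[OF z(1)] by (metis power_mono)
      define s' where "s' y = s y + t * z y" for y
      have s'V: "s' \<in> V" unfolding s'_def[abs_def] by (intro V_add V_cmult s z)
      have "structured \<phi> d (e1 + \<bar>t\<bar> * e2) s'"
        unfolding s'_def[abs_def] by (intro structured_add structured_cmult s z V_cmult)
      moreover have "e1 + \<bar>t\<bar> * e2 \<le> e0"
      proof -
        have "t * e2 \<le> t * (e0 / (2 * t))" using pos by (intro mult_left_mono) (auto simp: e2_def)
        then show ?thesis using pos by (simp add: e1_def)
      qed
      ultimately have "structured \<phi> d e0 s'" by (rule structured_mono)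
      moreover have "I (\<lambda>y. (u y - s' y)\<^sup>2) \<le> I (\<lambda>y. (u y)\<^sup>2) - real (Suc n) * (t * \<eta>\<^sup>2 / 2)"
      proof -
        have "I (\<lambda>y. (u y - s' y)\<^sup>2) = I (\<lambda>y. (r y + (- t) * z y)\<^sup>2)"
          by (simp add: r_def s'_def algebra_simps)
        also have "\<dots> = I (\<lambda>y. (r y)\<^sup>2) - 2 * (t * I (\<lambda>y. r y * z y)) + t * (t * I (\<lambda>y. (z y)\<^sup>2))"
          using I_square_add[OF rV z(1), of "- t"] by (simp add: power2_eq_square)
        also have "\<dots> \<le> I (\<lambda>y. (r y)\<^sup>2) - 2 * (t * (\<eta>\<^sup>2 / 2)) + t * (t * C\<^sup>2)"
          using pos rz zz by (intro add_mono diff_mono mult_left_mono order_refl) auto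
        also have "\<dots> = I (\<lambda>y. (r y)\<^sup>2) - t * \<eta>\<^sup>2 / 2" by (simp add: tC)
        finally show ?thesis using s(3) unfolding r_def of_nat_Suc distrib_right by linarith
      qed
      ultimately show "\<exists>s\<in>V. structured \<phi> d e0 s \<and> 
          I (\<lambda>y. (u y - s y)\<^sup>2) \<le> I (\<lambda>y. (u y)\<^sup>2) - real (Suc n) * (t * \<eta>\<^sup>2 / 2)"
        using s'V by blast
    qed
  qed
  have "t * \<eta>\<^sup>2 / 2 > 0" using pos by simp
  then obtain n where n: "I (\<lambda>y. (u y)\<^sup>2) < real n * (t * \<eta>\<^sup>2 / 2)"
    using reals_Archimedean3 by blast
  obtain s where "s \<in> V" "I (\<lambda>y. (u y - s y)\<^sup>2) \<le> I (\<lambda>y. (u y)\<^sup>2) - real n * (t * \<eta>\<^sup>2 / 2)"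
    using descent[of n] zero_less_one by blast
  moreover have "0 \<le> I (\<lambda>y. (u y - s y)\<^sup>2)" using \<open>s \<in> V\<close> u by (intro I_nonneg V_intros) auto
  ultimately show False using n by linarith
qed

text \<open>The induction on the number of slots ranges over all integrals and function algebras on
  the same space, because \<open>all_structured\<close> uses the previous case for fibred systems.
  The last function is structured, whatever unit functions precede it.\<close>

lemma multiple_averages_lift:
  fixes \<phi> :: "nat \<Rightarrow> 'g::ab_group_add \<Rightarrow> 'h::ab_group_add"
    and V :: "('g list \<times> 'x \<Rightarrow> real) set" and S0 :: "'h \<Rightarrow> 'x \<Rightarrow> 'x"
  assumes "mean_system V I (lift S0)" and hom: "\<And>i a b. \<phi> i (a + b) = \<phi> i a + \<phi> i b"
    and "\<And>i. i < d \<Longrightarrow> f i \<in> V" and "e > 0"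
  shows "mean_system.almost_conv I e (mean_system.mshift (lift S0) \<phi> d f)"
  using assms(1,3,4)
proof (induction d arbitrary: V I f e)
  case 0
  interpret mean_system V I "lift S0" by fact
  show ?case using \<open>e > 0\<close> 
    by (auto simp: almost_conv_def mshift_def nrm_def intro!: exI[of _ "[0]"])
next
  case (Suc d)
  interpret mean_system V I "lift S0" by fact
  have "\<exists>C>0. \<forall>i<Suc d. \<forall>y. \<bar>f i y\<bar> \<le> C"
  proof -
    have "\<forall>i\<in>{..<Suc d}. \<exists>C. \<forall>y. \<bar>f i y\<bar> \<le> C"
      using Suc.prems(2) V_bdd unfolding bdd_def by blast
    then obtain c where c: "\<And>i. i < Suc d \<Longrightarrow> \<forall>y. \<bar>f i y\<bar> \<le> c i"
      unfolding bchoice_iff by auto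
    have "\<bar>f i y\<bar> \<le> Max (insert 1 (c ` {..<Suc d}))" if "i < Suc d" for i y
    proof -
      have "\<bar>f i y\<bar> \<le> c i" using c[OF that] by blast
      also have "c i \<le> Max (insert 1 (c ` {..<Suc d}))" using that by (intro Max_ge) auto
      finally show ?thesis .
    qed
    moreover have "1 \<le> Max (insert 1 (c ` {..<Suc d}))" by (intro Max_ge) auto
    then have "0 < Max (insert 1 (c ` {..<Suc d}))" by linarith
    ultimately show ?thesis by blast
  qed
  then obtain C where C: "C > 0" "\<And>i y. i < Suc d \<Longrightarrow> \<bar>f i y\<bar> \<le> C" by blast
  define f' where "f' i y = 1 / C * f i y" for i y
  have f'V: "f' i \<in> V" if "i < Suc d" for i
    unfolding f'_def[abs_def] using Suc.prems(2) that by (intro V_cmult) auto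
  have "\<bar>f' i y\<bar> \<le> 1" if "i < Suc d" for i y
    using C(2)[OF that, of y] C(1) by (simp add: f'_def abs_mult)
  then have f': "unit_fns d f'" using f'V unfolding unit_fns_def by simp
  \<comment> \<open>Rescaling \<open>Suc d\<close> functions from sup bound 1 back to
    \<open>C\<close> multiplies the error by this power.\<close>
  have "structured \<phi> d (e / C ^ Suc d) (f' d)"
    using Suc.prems(1) hom Suc.IH f'V[of d] \<open>e > 0\<close> C(1) by (intro all_structured) auto
  then have "almost_conv (e / C ^ Suc d) (\<lambda>g y. mshift \<phi> d f' g y * f' d (lift S0 (\<phi> d g) y))"
    using f' by (simp add: structured_def)
  then have "almost_conv (e / C ^ Suc d) (mshift \<phi> (Suc d) f')"
    by (simp add: mshift_def[abs_def])
  then have "almost_conv (\<bar>C ^ Suc d\<bar> * (e / C ^ Suc d)) (\<lambda>g y. C ^ Suc d * mshift \<phi> (Suc d) f' g y)"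
    by (intro almost_conv_cmult mshift_V f'V)
  moreover have "C ^ Suc d * mshift \<phi> (Suc d) f' g y = mshift \<phi> (Suc d) f g y" for g y
  proof -
    have "mshift \<phi> (Suc d) f' g y = (\<Prod>i<Suc d. 1 / C) * mshift \<phi> (Suc d) f g y"
      unfolding mshift_def f'_def by (rule prod.distrib)
    then show ?thesis using C(1) by (simp add: power_one_over)
  qed
  ultimately show ?case using C(1) by simp
qed

text \<open>Walsh's theorem for linear averages over abelian groups, in its weak form.\<close>

theorem (in mean_system) multiple_correlations_almost_converge:
  fixes \<phi> :: "'j \<Rightarrow> 'g::ab_group_add \<Rightarrow> 'h"
  assumes "finite J" and hom: "\<And>j a b. \<phi> j (a + b) = \<phi> j a + \<phi> j b"
    and f: "\<And>j. j \<in> J \<Longrightarrow> f j \<in> V" and "e > 0"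
  obtains xs where "xs \<noteq> []" "\<And>h h'. \<bar>av xs (\<lambda>g. I (\<lambda>y. \<Prod>j\<in>J. f j (S (\<phi> j (g + h)) y)))
      - av xs (\<lambda>g. I (\<lambda>y. \<Prod>j\<in>J. f j (S (\<phi> j (g + h')) y)))\<bar> \<le> e"
proof -
  \<comment> \<open>The given system is placed over the empty list, as a fibration over one point
    whose mean is evaluation; this gives it the type on which the induction runs.\<close>
  let ?V = "{F :: 'g list \<times> 'y \<Rightarrow> real. bdd F \<and> (\<forall>u::unit. (\<lambda>y. F ([], y)) \<in> V)}"
  let ?I = "\<lambda>F :: 'g list \<times> 'y \<Rightarrow> real. (\<lambda>a. a ()) (\<lambda>u::unit. I (\<lambda>y. F ([], y)))"
  have "mean (\<lambda>a::unit \<Rightarrow> real. a ())" by unfold_locales auto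
  then have sys: "mean_system ?V ?I (lift S)"
    by (rule fibred_mean_system[OF mean_system_axioms, where \<iota>="\<lambda>_ y. ([], y)" and \<theta>="\<lambda>h _. h"])
       (auto simp: lift_def S_0 S_add)
  interpret L: mean_system ?V ?I "lift S :: 'h \<Rightarrow> 'g list \<times> 'y \<Rightarrow> 'g list \<times> 'y" by fact
  obtain b where b: "bij_betw b {0..<card J} J" using ex_bij_betw_nat_finite[OF \<open>finite J\<close>] by blast
  define F where "F i p = f (b i) (snd p)" for i and p :: "'g list \<times> 'y"
  have "F i \<in> ?V" if "i < card J" for i
  proof -
    have "f (b i) \<in> V" using bij_betwE[OF b] that by (intro f) auto
    then show ?thesis using V_bdd bdd_comp[of "f (b i)" snd] by (auto simp: F_def[abs_def])
  qed
  then have "L.almost_conv e (L.mshift (\<lambda>i. \<phi> (b i)) (card J) F)"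
    by (rule multiple_averages_lift[OF sys hom _ \<open>e > 0\<close>])
  then obtain xs where xs: "xs \<noteq> []" "\<And>h h'. L.nrm (\<lambda>y. 
       av xs (\<lambda>g. L.mshift (\<lambda>i. \<phi> (b i)) (card J) F (g + h) y) 
     - av xs (\<lambda>g. L.mshift (\<lambda>i. \<phi> (b i)) (card J) F (g + h') y)) \<le> e"
    unfolding L.almost_conv_def by blast
  have ms: "L.mshift (\<lambda>i. \<phi> (b i)) (card J) F g ([], y) = (\<Prod>j\<in>J. f j (S (\<phi> j g) y))" for g y
    unfolding L.mshift_def F_def lift_def using prod.reindex_bij_betw[OF b, of "\<lambda>j. f j (S (\<phi> j g) y)"]
    by (simp add: atLeast0LessThan)
  have "\<bar>av xs (\<lambda>g. I (\<lambda>y. \<Prod>j\<in>J. f j (S (\<phi> j (g + h)) y)))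
      - av xs (\<lambda>g. I (\<lambda>y. \<Prod>j\<in>J. f j (S (\<phi> j (g + h')) y)))\<bar> \<le> e" for h h'
  proof -
    let ?A = "\<lambda>h y. av xs (\<lambda>g. \<Prod>j\<in>J. f j (S (\<phi> j (g + h)) y))"
    have PV: "(\<lambda>y. \<Prod>j\<in>J. f j (S (\<phi> j g) y)) \<in> V" for g by (intro V_prod V_shift f)
    have AV: "?A k \<in> V" for k by (intro V_av PV)
    have "av xs (\<lambda>g. I (\<lambda>y. \<Prod>j\<in>J. f j (S (\<phi> j (g + h)) y)))
      - av xs (\<lambda>g. I (\<lambda>y. \<Prod>j\<in>J. f j (S (\<phi> j (g + h')) y))) = I (\<lambda>y. ?A h y - ?A h' y)"
      by (simp add: I_av[OF PV] I_diff[OF AV AV])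
    also have "\<bar>\<dots>\<bar> \<le> nrm (\<lambda>y. ?A h y - ?A h' y)" by (intro I_abs_le_nrm V_diff AV)
    also have "\<dots> \<le> e" using xs(2)[of h h'] by (simp add: L.nrm_def nrm_def ms)
    finally show ?thesis .
  qed
  with xs(1) show ?thesis using that by blast
qed

section \<open>Khintchine recurrence for cubes\<close>

context mean_system
begin

text \<open>The mean ergodic theorem in approximate form. An exact representative of
  \<open>l\<close> would be the projection Pf of \<open>f\<close> to the invariant functions, and
  the pairing of f with Pf is |Pf|^2, at least the squared integral of Pf, which equals that of f.
  Here \<open>z\<close> plays the role of Pf.\<close>

lemma mean_correlation_ge:
  assumes "mean m" and inv: "\<And>a g. bdd a \<Longrightarrow> m (\<lambda>x. a (x + g)) = m a" and f: "f \<in> V"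
  shows "(I f)\<^sup>2 \<le> m (\<lambda>p. I (\<lambda>y. f y * f (S p y)))"
proof -
  interpret m: mean m by fact
  define b where "b p = I (\<lambda>y. f y * f (S p y))" for p
  define l where "l q = m (\<lambda>p. I (\<lambda>y. q y * f (S p y)))" for q
  have le: "\<bar>I (\<lambda>y. q y * f (S p y))\<bar> \<le> nrm f * nrm q" if "q \<in> V" for q p
    using Cauchy_Schwarz[OF that V_shift[OF f], of p] by (simp add: nrm_shift f mult.commute)
  have bd: "bdd (\<lambda>p. I (\<lambda>y. q y * f (S p y)))" if "q \<in> V" for q
    using le[OF that] by (rule bddI)
  have l_add: "l (\<lambda>y. p y + q y) = l p + l q" if "p \<in> V" "q \<in> V" for p q
  proof -
    have "I (\<lambda>y. (p y + q y) * f (S r y)) = I (\<lambda>y. p y * f (S r y)) + I (\<lambda>y. q y * f (S r y))" for r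
      unfolding distrib_right by (intro I_add V_mult V_shift f that)
    then show ?thesis by (simp add: l_def m.add bd that)
  qed
  have l_cmult: "l (\<lambda>y. c * q y) = c * l q" if "q \<in> V" for c q
  proof -
    have "I (\<lambda>y. c * q y * f (S r y)) = c * I (\<lambda>y. q y * f (S r y))" for r
      unfolding mult.assoc by (intro I_cmult V_mult V_shift f that)
    then show ?thesis by (simp add: l_def m.cmult bd that)
  qed
  have l_le: "\<bar>l q\<bar> \<le> nrm f * nrm q" if "q \<in> V" for q
    unfolding l_def using le[OF that] by (rule m.abs_le)
  have l_shift: "l (\<lambda>y. f (S p' y)) = m b" for p'
  proof -
    have "I (\<lambda>y. f (S p' y) * f (S p y)) = b (p + - p')" for p
      unfolding b_def by (subst I_unshift[OF f V_shift[OF f]]) (simp flip: S_add)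
    moreover have "bdd b" using bd[OF f] by (simp add: b_def[abs_def])
    ultimately show ?thesis using inv[of b "- p'"] by (simp add: l_def)
  qed
  define N where "N = nrm f + 1"
  have approx: "(I f)\<^sup>2 \<le> m b + e * (5 * N)" if e: "0 < e" "e \<le> 1" for e
  proof -
    obtain z where z: "z \<in> V" "\<And>q. q \<in> V \<Longrightarrow> \<bar>l q - I (\<lambda>y. q y * z y)\<bar> \<le> e * nrm q"
      using approximate_Riesz[of l "nrm f" e, OF l_add l_cmult l_le \<open>0 < e\<close>] by blast
    \<comment> \<open>Since \<open>l\<close> has the value \<open>m b\<close> on every translate of
      \<open>f\<close>, the pairings of \<open>z\<close> with all these translates are nearly
      \<open>m b\<close>; their mean is \<open>l z\<close>.\<close>
    have "\<bar>m (\<lambda>p. I (\<lambda>y. z y * f (S p y)) - m b)\<bar> \<le> e * nrm f"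
    proof (rule m.abs_le)
      fix p show "\<bar>I (\<lambda>y. z y * f (S p y)) - m b\<bar> \<le> e * nrm f"
        using z(2)[OF V_shift[OF f], of p] by (simp add: l_shift nrm_shift f abs_minus_commute mult.commute)
    qed
    then have 1: "\<bar>l z - m b\<bar> \<le> e * nrm f" by (simp add: m.diff bd z l_def)
    have 2: "\<bar>l z - (nrm z)\<^sup>2\<bar> \<le> e * nrm z" using z(2)[OF z(1)] nrm_square[OF z(1)]
      by (simp add: power2_eq_square)
    have 3: "\<bar>I f - I z\<bar> \<le> e"
      using z(2)[OF V_const[of 1]] I_shift[OF f] by (simp add: l_def nrm_def)
    have 4: "nrm z \<le> nrm f + e"
    proof (rule nrm_leI[OF z(1)])
      show "0 \<le> nrm f + e" using nrm_nonneg[OF f] e by simp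
      have "I (\<lambda>y. z y * z y) \<le> nrm f * nrm z + e * nrm z"
        using z(2)[OF z(1)] l_le[OF z(1)] unfolding abs_le_iff by linarith
      then show "I (\<lambda>y. z y * z y) \<le> (nrm f + e) * nrm z" by (simp add: distrib_right)
    qed
    have "\<bar>I f\<bar> \<le> nrm z + e" using 3 I_abs_le_nrm[OF z(1)] by linarith
    then have "(I f)\<^sup>2 \<le> (nrm z + e)\<^sup>2" by (metis abs_ge_zero power2_abs power_mono)
    also have "\<dots> = (nrm z)\<^sup>2 + e * (2 * nrm z + e)" by (simp add: power2_eq_square algebra_simps)
    also have "\<dots> \<le> (m b + e * nrm f + e * nrm z) + e * (2 * nrm z + e)" using 1 2 by linarith
    also have "\<dots> = m b + e * (nrm f + 3 * nrm z + e)" by (simp add: algebra_simps)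
    also have "\<dots> \<le> m b + e * (5 * N)"
      using e 4 nrm_nonneg[OF f] by (intro add_left_mono mult_left_mono) (auto simp: N_def)
    finally show ?thesis .
  qed
  have "N > 0" using nrm_nonneg[OF f] by (simp add: N_def add_nonneg_pos)
  show ?thesis
  proof (rule ccontr)
    assume "\<not> ?thesis"
    then have lt: "m b < (I f)\<^sup>2" by (simp add: b_def[abs_def])
    define e where "e = min 1 (((I f)\<^sup>2 - m b) / (10 * N))"
    have "0 < e" using lt \<open>N > 0\<close> by (simp add: e_def)
    then have "(I f)\<^sup>2 \<le> m b + e * (5 * N)" by (rule approx) (simp add: e_def)
    also have "\<dots> \<le> m b + (((I f)\<^sup>2 - m b) / (10 * N)) * (5 * N)"
      using \<open>N > 0\<close> by (intro add_left_mono mult_right_mono) (auto simp: e_def)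
    also have "\<dots> = m b + ((I f)\<^sup>2 - m b) / 2" using \<open>N > 0\<close> by (simp add: field_simps)
    finally show False using lt by argo
  qed
qed

definition cube :: "nat \<Rightarrow> ('y \<Rightarrow> real) \<Rightarrow> (nat \<Rightarrow> 'h) \<Rightarrow> real" where
  "cube k f c = I (\<lambda>y. \<Prod>\<omega>\<in>Pow {..<k}. f (S (\<Sum>i\<in>\<omega>. c i) y))"

lemma cube_cong: 
  assumes "\<And>i. i < k \<Longrightarrow> c i = c' i" shows "cube k f c = cube k f c'"
proof -
  have "(\<Sum>i\<in>\<omega>. c i) = (\<Sum>i\<in>\<omega>. c' i)" if "\<omega> \<in> Pow {..<k}" for \<omega>
    using that assms by (intro sum.cong) auto
  then have "(\<Prod>\<omega>\<in>Pow {..<k}. f (S (\<Sum>i\<in>\<omega>. c i) y)) = (\<Prod>\<omega>\<in>Pow {..<k}. f (S (\<Sum>i\<in>\<omega>. c' i) y))" for y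
    by (intro prod.cong) auto
  then show ?thesis by (simp add: cube_def)
qed

text \<open>Vertices are paired as \<open>\<omega>\<close> and \<open>insert k \<omega>\<close>, so
  the top direction is absorbed into the function.\<close>

lemma cube_Suc: "cube (Suc k) f c = cube k (\<lambda>y. f y * f (S (c k) y)) c"
proof -
  have "(\<Prod>\<omega>\<in>Pow {..<Suc k}. f (S (\<Sum>i\<in>\<omega>. c i) y))
      = (\<Prod>\<omega>\<in>Pow {..<k}. f (S (\<Sum>i\<in>\<omega>. c i) y) * f (S (c k) (S (\<Sum>i\<in>\<omega>. c i) y)))" for y
  proof -
    have "(\<Prod>\<omega>\<in>Pow {..<Suc k}. f (S (\<Sum>i\<in>\<omega>. c i) y))
        = (\<Prod>\<omega>\<in>Pow {..<k}. f (S (\<Sum>i\<in>\<omega>. c i) y)) * (\<Prod>\<omega>\<in>insert k ` Pow {..<k}. f (S (\<Sum>i\<in>\<omega>. c i) y))"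
      unfolding lessThan_Suc Pow_insert by (rule prod.union_disjoint) auto
    also have "(\<Prod>\<omega>\<in>insert k ` Pow {..<k}. f (S (\<Sum>i\<in>\<omega>. c i) y))
        = (\<Prod>\<omega>\<in>Pow {..<k}. f (S (\<Sum>i\<in>insert k \<omega>. c i) y))"
      by (subst prod.reindex) (auto simp: inj_on_def insert_eq_iff)
    also have "\<dots> = (\<Prod>\<omega>\<in>Pow {..<k}. f (S (c k) (S (\<Sum>i\<in>\<omega>. c i) y)))"
    proof (rule prod.cong[OF refl])
      fix \<omega> assume "\<omega> \<in> Pow {..<k}"
      then have "finite \<omega>" "k \<notin> \<omega>" using finite_subset by auto
      then show "f (S (\<Sum>i\<in>insert k \<omega>. c i) y) = f (S (c k) (S (\<Sum>i\<in>\<omega>. c i) y))"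
        by (simp add: S_add)
    qed
    finally show ?thesis by (simp add: prod.distrib)
  qed
  then show ?thesis by (simp add: cube_def)
qed

text \<open>The directions are chosen one at a time, from the top. For each j the mean over p of the
  pair correlations is at least the squared integral, so some single p is nearly good enough for the
  average over j. The family index is carried along because the offsets \<open>b j\<close> make the
  new functions differ.\<close>

lemma ex_large_cube_average:
  fixes b :: "'j \<Rightarrow> nat \<Rightarrow> 'h"
  assumes "\<And>j. F j \<in> V" "\<And>j y. 0 \<le> F j y" "0 < e" "xs \<noteq> []"
  shows "\<exists>c. av xs (\<lambda>j. I (F j) ^ (2 ^ k)) - e \<le> av xs (\<lambda>j. cube k (F j) (\<lambda>i. b j i + c i))"
  using assms(1-3)
proof (induction k arbitrary: F e)
  case 0
  then show ?case by (simp add: cube_def S_0)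
next
  case (Suc k)
  obtain m :: "('h \<Rightarrow> real) \<Rightarrow> real" where m: "mean m" "\<And>a g. bdd a \<Longrightarrow> m (\<lambda>x. a (x + g)) = m a"
    using ex_invariant_mean by blast
  interpret m: mean m by fact
  define G where "G p j y = F j y * F j (S (b j k + p) y)" for p j y
  have GV: "G p j \<in> V" for p j unfolding G_def[abs_def] by (intro V_mult V_shift Suc.prems)
  have G0: "0 \<le> G p j y" for p j y using Suc.prems by (simp add: G_def)
  have Gb: "bdd (\<lambda>p. I (G p j))" for j
    using Cauchy_Schwarz[OF Suc.prems(1) V_shift[OF Suc.prems(1)]]
    by (intro bddI[of _ "nrm (F j) * nrm (F j)"]) (auto simp: G_def[abs_def] nrm_shift Suc.prems(1))
  \<comment> \<open>Invariance of \<open>m\<close> absorbs the offset \<open>b j k\<close>, so one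
    variable p works for all j.\<close>
  have Gm: "(I (F j))\<^sup>2 \<le> m (\<lambda>p. I (G p j))" for j
  proof -
    define \<beta> where "\<beta> p = I (\<lambda>y. F j y * F j (S p y))" for p
    have "bdd \<beta>" using bdd_comp[OF Gb[of j], of "\<lambda>p. p - b j k"]
      by (simp add: \<beta>_def[abs_def] G_def[abs_def])
    moreover have "(\<lambda>p. I (G p j)) = (\<lambda>p. \<beta> (p + b j k))" by (simp add: \<beta>_def G_def[abs_def] add.commute)
    ultimately have "m (\<lambda>p. I (G p j)) = m \<beta>" using m(2) by simp
    then show ?thesis using mean_correlation_ge[OF m Suc.prems(1)] by (simp add: \<beta>_def[abs_def])
  qed
  have G0': "0 \<le> I (G p j)" for p j by (intro I_nonneg GV G0)
  note pw = m.power_ge[OF Gb G0', of _ k]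
  let ?v = "av xs (\<lambda>j. I (F j) ^ (2 ^ Suc k))"
  have "?v = av xs (\<lambda>j. ((I (F j))\<^sup>2) ^ (2 ^ k))" by (simp add: power_mult)
  also have "\<dots> \<le> av xs (\<lambda>j. m (\<lambda>p. I (G p j)) ^ (2 ^ k))"
    by (intro av_mono power_mono Gm) auto
  also have "\<dots> \<le> av xs (\<lambda>j. m (\<lambda>p. I (G p j) ^ (2 ^ k)))" using pw by (intro av_mono) blast
  also have "\<dots> = m (\<lambda>p. av xs (\<lambda>j. I (G p j) ^ (2 ^ k)))"
    using pw by (intro m.average[THEN conjunct1, symmetric]) blast
  finally have v: "?v \<le> m (\<lambda>p. av xs (\<lambda>j. I (G p j) ^ (2 ^ k)))" .
  have "\<exists>p. ?v - e / 2 \<le> av xs (\<lambda>j. I (G p j) ^ (2 ^ k))"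
  proof (rule ccontr)
    assume "\<not> ?thesis"
    then have "m (\<lambda>p. av xs (\<lambda>j. I (G p j) ^ (2 ^ k))) \<le> ?v - e / 2"
      using m.average[of xs "\<lambda>p j. I (G p j) ^ (2 ^ k)"] pw by (intro m.le) (auto simp: not_le less_imp_le)
    then show False using v \<open>e > 0\<close> by linarith
  qed
  then obtain p where p: "?v - e / 2 \<le> av xs (\<lambda>j. I (G p j) ^ (2 ^ k))" by blast
  obtain c where c: "av xs (\<lambda>j. I (G p j) ^ (2 ^ k)) - e / 2 \<le> av xs (\<lambda>j. cube k (G p j) (\<lambda>i. b j i + c i))"
    using Suc.IH[of "G p" "e / 2"] GV G0 \<open>e > 0\<close> by auto
  have eq: "cube k (G p j) (\<lambda>i. b j i + c i) = cube (Suc k) (F j) (\<lambda>i. b j i + (c(k := p)) i)" for j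
    unfolding cube_Suc by (subst cube_cong[of k _ "\<lambda>i. b j i + c i"]) (auto simp: G_def[abs_def])
  show ?case using p c unfolding eq by (intro exI[of _ "c(k := p)"]) linarith
qed

text \<open>Syndeticity in the discrete sense. Almost convergence over the group
  \<open>nat \<Rightarrow> 'h\<close> gives a list whose averages of cubes hardly depend on the
  translate c; one translate has a large average, so all do, and each list contains a large
  term.\<close>

lemma ex_list_large_cubes:
  assumes "f \<in> V" "\<And>y. 0 \<le> f y" "0 < e"
  obtains xs :: "(nat \<Rightarrow> 'h) list" where "\<And>c. \<exists>b\<in>set xs. I f ^ (2 ^ k) - e \<le> cube k f (\<lambda>i. b i + c i)"
proof -
  have e3: "0 < e / 3" using \<open>0 < e\<close> by simp
  have hom: "(\<Sum>i\<in>\<omega>. (a + b) i) = (\<Sum>i\<in>\<omega>. a i) + (\<Sum>i\<in>\<omega>. b i)" for \<omega> and a b :: "nat \<Rightarrow> 'h"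
    by (simp add: sum.distrib)
  obtain xs :: "(nat \<Rightarrow> 'h) list" where xs: "xs \<noteq> []" 
    "\<And>h h'. \<bar>av xs (\<lambda>b. cube k f (b + h)) - av xs (\<lambda>b. cube k f (b + h'))\<bar> \<le> e / 3"
    unfolding cube_def
    using multiple_correlations_almost_converge[of "Pow {..<k}" "\<lambda>\<omega> b. \<Sum>i\<in>\<omega>. b i" "\<lambda>_. f" "e / 3", OF _ hom assms(1) e3]
    by auto
  obtain c0 where c0: "I f ^ (2 ^ k) - e / 3 \<le> av xs (\<lambda>b. cube k f (\<lambda>i. b i + c0 i))"
    using ex_large_cube_average[of "\<lambda>_. f" "e / 3" xs k "\<lambda>b. b"] assms xs(1) e3 by auto
  have plus: "b + c = (\<lambda>i. b i + c i)" for b c :: "nat \<Rightarrow> 'h" by (simp add: plus_fun_def)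
  have "\<exists>b\<in>set xs. I f ^ (2 ^ k) - e \<le> cube k f (\<lambda>i. b i + c i)" for c
  proof (rule ccontr)
    assume "\<not> ?thesis"
    then have "av xs (\<lambda>b. cube k f (\<lambda>i. b i + c i)) \<le> I f ^ (2 ^ k) - e"
      by (intro av_le xs(1)) (auto simp: not_le less_imp_le)
    then show False using c0 xs(2)[of c c0] \<open>0 < e\<close> unfolding plus abs_le_iff by linarith
  qed
  then show ?thesis using that by blast
qed

end

section \<open>The group of endomorphisms\<close>

text \<open>A type of its own makes the endomorphisms an instance of \<open>ab_group_add\<close>, so
  that they can be the acting group of a \<open>mean_system\<close>.\<close>

typedef (overloaded) 'g endo = "Hom :: ('g::ab_group_add \<Rightarrow> 'g) set" morphisms app Endo
  by (rule exI[of _ "\<lambda>_. 0"]) (simp add: Hom_def)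

lemma app_add: "app \<psi> (x + y) = app \<psi> x + app \<psi> y"
  using app[of \<psi>] by (simp add: Hom_def)

instantiation endo :: (ab_group_add) ab_group_add
begin

definition "0 = Endo (\<lambda>_. 0)"
definition "\<psi> + \<psi>' = Endo (\<lambda>g. app \<psi> g + app \<psi>' g)"
definition "- \<psi> = Endo (\<lambda>g. - app \<psi> g)"
definition "\<psi> - \<psi>' = Endo (\<lambda>g. app \<psi> g - app \<psi>' g)"

lemma app_zero: "app 0 g = 0"
  by (simp add: zero_endo_def Endo_inverse Hom_def)

lemma app_plus: "app (\<psi> + \<psi>') g = app \<psi> g + app \<psi>' g"
  by (simp add: plus_endo_def Endo_inverse Hom_def app_add)

lemma app_uminus: "app (- \<psi>) g = - app \<psi> g"
  by (simp add: uminus_endo_def Endo_inverse Hom_def app_add)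

lemma app_minus: "app (\<psi> - \<psi>') g = app \<psi> g - app \<psi>' g"
  by (simp add: minus_endo_def Endo_inverse Hom_def app_add)

instance
  by standard (simp_all add: app_inject[symmetric] fun_eq_iff app_zero app_plus app_uminus app_minus algebra_simps)

end

lemma app_sum: "app (\<Sum>i\<in>\<omega>. c i) g = (\<Sum>i\<in>\<omega>. app (c i) g)"
  by (induction \<omega> rule: infinite_finite_induct) (auto simp: app_zero app_plus)

section \<open>Measure-preserving systems\<close>

text \<open>\<^term>\<open>T\<close> is only assumed to be an action on \<^term>\<open>space M\<close>.\<close>

definition total_action :: "'x measure \<Rightarrow> ('g \<Rightarrow> 'x \<Rightarrow> 'x) \<Rightarrow> 'g \<Rightarrow> 'x \<Rightarrow> 'x" where
  "total_action M T g x = (if x \<in> space M then T g x else x)"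

lemma mp_G_system_mean_system:
  assumes "mp_G_system M T"
  shows "mean_system {f. f \<in> borel_measurable M \<and> bdd f} (\<lambda>f. \<integral>x. f x \<partial>M) (total_action M T)"
proof -
  interpret prob_space M using assms by (simp add: mp_G_system_def)
  have T: "T g \<in> measurable M M" "distr M M (T g) = M" for g
    using assms by (auto simp: mp_G_system_def)
  have Ts: "T g x \<in> space M" if "x \<in> space M" for g x
    using measurable_space[OF T(1) that] .
  have int: "integrable M f" if "f \<in> borel_measurable M" "bdd f" for f :: "'a \<Rightarrow> real"
  proof -
    obtain C where "\<And>x. \<bar>f x\<bar> \<le> C" using \<open>bdd f\<close> by (auto elim!: bddE)
    then show ?thesis using that by (intro integrable_const_bound[of _ C]) auto
  qed
  have meas: "(\<lambda>x. f (total_action M T h x)) \<in> borel_measurable M" if "f \<in> borel_measurable M" for f :: "'a \<Rightarrow> real" and h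
    using measurable_compose[OF T(1)[of h] that]
    by (subst measurable_cong[of M _ "\<lambda>x. f (T h x)"]) (auto simp: total_action_def)
  show ?thesis
  proof (unfold_locales, goal_cases)
    case (1 f) then show ?case by simp
  next
    case (2 c) then show ?case by simp
  next
    case (3 f g) then show ?case by auto
  next
    case (4 f g) then show ?case by auto
  next
    case (5 f h) then show ?case by (auto intro: meas bdd_comp)
  next
    case (6 f g) then show ?case by (simp add: int)
  next
    case (7 f c) then show ?case by simp
  next
    case (8 f) then show ?case by simp
  next
    case 9 then show ?case by (simp add: prob_space)
  next
    case (10 f h)
    have "(\<integral>x. f (total_action M T h x) \<partial>M) = (\<integral>x. f (T h x) \<partial>M)"
      by (intro Bochner_Integration.integral_cong) (auto simp: total_action_def)
    also have "\<dots> = (\<integral>x. f x \<partial>distr M M (T h))" using 10 T(1) by (intro integral_distr[symmetric]) auto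
    finally show ?case by (simp add: T(2))
  next
    case (11 y) then show ?case using assms by (simp add: total_action_def mp_G_system_def)
  next
    case (12 a b y) then show ?case using assms Ts by (simp add: total_action_def mp_G_system_def)
  qed
qed

lemma topspace_homk: "topspace (homk_top k) = (\<Pi>\<^sub>E i\<in>{..<k}. Hom)"
  by (simp add: homk_top_def hom_top_def)

theorem theorem13p3:
  fixes M :: "'x measure" and T :: "'g::{countable, ab_group_add} \<Rightarrow> 'x \<Rightarrow> 'x"
    and A :: "'x set" and k :: nat and \<epsilon> :: real
  assumes "mp_G_system M T"
    and "A \<in> sets M"
    and "\<epsilon> > 0"
  shows "\<exists>S. S \<subseteq> topspace (homk_top k) \<and> syndetic_homk k S \<and>
           (\<forall>\<phi>\<in>S. syndetic_discrete (R_eps M T A k \<epsilon> \<phi>))"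
proof -
  interpret prob_space M using assms by (simp add: mp_G_system_def)
  let ?V = "{f. f \<in> borel_measurable M \<and> bdd f}" and ?I = "\<lambda>f. \<integral>x. f x \<partial>M"
  note base = mp_G_system_mean_system[OF assms(1)]
  interpret B: mean_system ?V ?I "total_action M T" by (rule base)
  obtain m :: "('g \<Rightarrow> real) \<Rightarrow> real" where m: "mean m" "\<And>a g. bdd a \<Longrightarrow> m (\<lambda>x. a (x + g)) = m a"
    using ex_invariant_mean by blast
  interpret m: mean m by fact

  define f :: "'x \<Rightarrow> real" where "f = indicator A"
  have fV: "f \<in> ?V" using assms(2) by (auto simp: f_def intro!: bddI[of _ 1] split: split_indicator)
  define a where "a c g = ?I (\<lambda>x. \<Prod>\<omega>\<in>Pow {..<k}. f (total_action M T (\<Sum>i\<in>\<omega>. app (c i) g) x))"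
    for c :: "nat \<Rightarrow> 'g endo" and g
  have PV: "(\<lambda>x. \<Prod>\<omega>\<in>Pow {..<k}. f (total_action M T (s \<omega>) x)) \<in> ?V" for s
    by (intro B.V_prod B.V_shift fV)
  have a_bdd: "bdd (a c)" for c
    unfolding a_def
    by (intro bddI[of _ 1] B.I_abs_le PV) (auto simp: abs_prod f_def intro!: prod_le_1)

  \<comment> \<open>Extensional tuples are undefined from index k on; the padding by 0 is never read
    by a cube of dimension k.\<close>
  define rep where "rep \<phi> i = (if i < k then Endo (\<phi> i) else 0)" for \<phi> :: "nat \<Rightarrow> 'g \<Rightarrow> 'g" and i
  have rep: "app (rep \<phi> i) = \<phi> i" if "\<phi> \<in> topspace (homk_top k)" "i < k" for \<phi> i
    using that by (auto simp: rep_def topspace_homk intro!: Endo_inverse)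

  have R: "R_eps M T A k \<epsilon> \<phi> = {g. a (rep \<phi>) g > measure M A ^ (2 ^ k) - \<epsilon>}"
    if \<phi>: "\<phi> \<in> topspace (homk_top k)" for \<phi>
  proof -
    have "a (rep \<phi>) g = measure M (\<Inter>\<omega>\<in>Pow {..<k}. T (\<Sum>i\<in>\<omega>. \<phi> i g) -` A \<inter> space M)" for g
    proof -
      let ?B = "\<Inter>\<omega>\<in>Pow {..<k}. T (\<Sum>i\<in>\<omega>. \<phi> i g) -` A \<inter> space M"
      have sums: "(\<Sum>i\<in>\<omega>. app (rep \<phi> i) g) = (\<Sum>i\<in>\<omega>. \<phi> i g)" if "\<omega> \<in> Pow {..<k}" for \<omega>
        using that by (intro sum.cong) (auto simp: rep[OF \<phi>])
      have "a (rep \<phi>) g = (\<integral>x. indicator ?B x \<partial>M)"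
        unfolding a_def
      proof (rule Bochner_Integration.integral_cong[OF refl])
        fix x assume x: "x \<in> space M"
        have "(\<Prod>\<omega>\<in>Pow {..<k}. f (total_action M T (\<Sum>i\<in>\<omega>. app (rep \<phi> i) g) x))
            = (\<Prod>\<omega>\<in>Pow {..<k}. indicator (T (\<Sum>i\<in>\<omega>. \<phi> i g) -` A \<inter> space M) x)"
          using x by (intro prod.cong refl) (simp add: sums f_def total_action_def indicator_def)
        also have "\<dots> = indicator ?B x"
        proof (cases "x \<in> ?B")
          case True
          then have "x \<in> T (\<Sum>i\<in>\<omega>. \<phi> i g) -` A \<inter> space M" if "\<omega> \<in> Pow {..<k}" for \<omega>
            using that by blast
          then show ?thesis using True by (subst prod.neutral) auto
        next
          case False
          then obtain \<omega> where "\<omega> \<in> Pow {..<k}" "x \<notin> T (\<Sum>i\<in>\<omega>. \<phi> i g) -` A \<inter> space M" by blast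
          then show ?thesis using False by (subst prod_zero) (auto intro!: bexI[of _ \<omega>])
        qed
        finally show "(\<Prod>\<omega>\<in>Pow {..<k}. f (total_action M T (\<Sum>i\<in>\<omega>. app (rep \<phi> i) g) x)) = indicator ?B x" .
      qed
      also have "\<dots> = measure M ?B"
        by (subst Bochner_Integration.integral_indicator) (auto intro!: arg_cong[where f="measure M"])
      finally show ?thesis .
    qed
    then show ?thesis by (simp add: R_eps_def)
  qed

  define \<gamma> where "\<gamma> = measure M A ^ (2 ^ k)"
  have synd_R: "syndetic_discrete (R_eps M T A k \<epsilon> \<phi>)"
    if \<phi>: "\<phi> \<in> topspace (homk_top k)" and ma: "\<gamma> - \<epsilon> / 2 \<le> m (a (rep \<phi>))" for \<phi>
  proof -
    have hom: "(\<Sum>i\<in>\<omega>. app (rep \<phi> i) (g + h)) = (\<Sum>i\<in>\<omega>. app (rep \<phi> i) g) + (\<Sum>i\<in>\<omega>. app (rep \<phi> i) h)" 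
      for \<omega> g h
      by (simp add: app_add sum.distrib)
    have "\<epsilon> / 8 > 0" using assms(3) by simp
    then obtain xs where xs: "xs \<noteq> []" "\<And>h h'. \<bar>av xs (\<lambda>g. a (rep \<phi>) (g + h)) - av xs (\<lambda>g. a (rep \<phi>) (g + h'))\<bar> \<le> \<epsilon> / 8"
      unfolding a_def
      using B.multiple_correlations_almost_converge[of "Pow {..<k}" "\<lambda>\<omega> g. \<Sum>i\<in>\<omega>. app (rep \<phi> i) g" "\<lambda>_. f" "\<epsilon> / 8", OF _ hom fV]
      by auto
    note ab = m.average[of xs "\<lambda>h g. a (rep \<phi>) (g + h)", OF bdd_comp[OF a_bdd]]
    have "m (\<lambda>h. av xs (\<lambda>g. a (rep \<phi>) (g + h))) = av xs (\<lambda>g. m (\<lambda>h. a (rep \<phi>) (g + h)))"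
      using ab by blast
    also have "\<dots> = m (a (rep \<phi>))" using m(2)[OF a_bdd] xs(1) by (simp add: add.commute)
    finally have avm: "m (\<lambda>h. av xs (\<lambda>g. a (rep \<phi>) (g + h))) = m (a (rep \<phi>))" .
    \<comment> \<open>The mean over h of these averages is \<open>m (a (rep \<phi>))\<close>, so one
      of them is almost that large. Passing to an arbitrary translate costs another
      \<open>\<epsilon> / 8\<close>, and the total loss stays below
      \<open>\<epsilon>\<close>.\<close>
    have "\<exists>h. \<gamma> - \<epsilon> / 2 - \<epsilon> / 8 < av xs (\<lambda>g. a (rep \<phi>) (g + h))"
    proof (rule ccontr)
      assume "\<not> ?thesis"
      then have "m (\<lambda>h. av xs (\<lambda>g. a (rep \<phi>) (g + h))) \<le> \<gamma> - \<epsilon> / 2 - \<epsilon> / 8"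
        using ab by (intro m.le) (auto simp: not_less)
      then show False using avm ma assms(3) by linarith
    qed
    then obtain h0 where h0: "\<gamma> - \<epsilon> / 2 - \<epsilon> / 8 < av xs (\<lambda>g. a (rep \<phi>) (g + h0))" by blast
    have ex: "\<exists>g\<in>set xs. a (rep \<phi>) (g + h) > \<gamma> - \<epsilon>" for h
    proof (rule ccontr)
      assume "\<not> ?thesis"
      then have "av xs (\<lambda>g. a (rep \<phi>) (g + h)) \<le> \<gamma> - \<epsilon>" by (intro av_le xs(1)) (auto simp: not_less)
      then show False using h0 xs(2)[of h h0] assms(3) unfolding abs_le_iff by linarith
    qed
    have "h \<in> (\<Union>x\<in>uminus ` set xs. (\<lambda>r. x + r) ` R_eps M T A k \<epsilon> \<phi>)" for h
    proof -
      obtain g where g: "g \<in> set xs" "a (rep \<phi>) (g + h) > \<gamma> - \<epsilon>" using ex by blast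
      then have "g + h \<in> R_eps M T A k \<epsilon> \<phi>" using R[OF \<phi>] by (simp add: \<gamma>_def)
      moreover have "h = - g + (g + h)" by simp
      ultimately show ?thesis using g(1) by blast
    qed
    then show ?thesis unfolding syndetic_discrete_def
      by (intro exI[of _ "uminus ` set xs"]) auto
  qed

  \<comment> \<open>Membership asks for a large mean over g; half of \<open>\<epsilon>\<close> is
    kept in reserve for the passage from the mean to individual g.\<close>
  define S where "S = {\<phi> \<in> topspace (homk_top k). \<gamma> - \<epsilon> / 2 \<le> m (a (rep \<phi>))}"
  have "syndetic_homk k S"
  proof -
    \<comment> \<open>On the fibre over g an endomorphism \<open>\<psi>\<close> acts through its
      value at g. The cube correlations of the lifted indicator in this system are exactly the means
      \<open>m (a c)\<close>.\<close>
    let ?V' = "{F :: 'g \<times> 'x \<Rightarrow> real. bdd F \<and> (\<forall>g. (\<lambda>x. F (g, x)) \<in> ?V)}"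
    let ?I' = "\<lambda>F. m (\<lambda>g. ?I (\<lambda>x. F (g, x)))"
    let ?S' = "\<lambda>(\<psi> :: 'g endo) p. (fst p, total_action M T (app \<psi> (fst p)) (snd p))"
    have sys': "mean_system ?V' ?I' ?S'"
      by (rule fibred_mean_system[OF base m(1), where \<theta>="\<lambda>\<psi> g. app \<psi> g"])
         (auto simp: app_zero app_plus B.S_0 B.S_add)
    interpret E: mean_system ?V' ?I' ?S' by (rule sys')
    define F where "F p = f (snd p)" for p :: "'g \<times> 'x"
    have FV: "F \<in> ?V'" using fV bdd_comp[of f snd] by (auto simp: F_def[abs_def])
    have IF: "?I' F = measure M A" using assms(2) by (simp add: F_def f_def)
    have cube: "E.cube k F c = m (a c)" for c
      by (simp add: E.cube_def F_def a_def[abs_def] app_sum)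
    obtain xs where xs: "\<And>c. \<exists>b\<in>set xs. \<gamma> - \<epsilon> / 2 \<le> m (a (\<lambda>i. b i + c i))"
      using E.ex_list_large_cubes[OF FV, of "\<epsilon> / 2" k] assms(3) unfolding IF cube \<gamma>_def
      by (auto simp: F_def f_def)
    \<comment> \<open>For every tuple some b in \<open>xs\<close> moves it into \<open>S\<close>, so
      the negatives of these b move \<open>S\<close> over the whole group. Being finite, the set is
      compact.\<close>
    define K where "K = (\<lambda>b. restrict (\<lambda>i. app (- b i)) {..<k}) ` set xs"
    have K: "K \<subseteq> topspace (homk_top k)" by (auto simp: K_def topspace_homk app)
    have "finite K" by (simp add: K_def)
    then have "compactin (homk_top k) K" using K by (intro finite_imp_compactin) auto
    moreover have "topspace (homk_top k) = {tuple_add k s c | s c. s \<in> S \<and> c \<in> K}"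
    proof (intro equalityI subsetI)
      fix \<phi> :: "nat \<Rightarrow> 'g \<Rightarrow> 'g" assume \<phi>: "\<phi> \<in> topspace (homk_top k)"
      obtain b where b: "b \<in> set xs" "\<gamma> - \<epsilon> / 2 \<le> m (a (\<lambda>i. b i + rep \<phi> i))" using xs by blast
      define s where "s = restrict (\<lambda>i. app (b i + rep \<phi> i)) {..<k}"
      have s: "s \<in> topspace (homk_top k)" by (auto simp: s_def topspace_homk app)
      have "m (a (rep s)) = m (a (\<lambda>i. b i + rep \<phi> i))"
        unfolding cube[symmetric] by (intro E.cube_cong) (simp add: rep_def s_def app_inverse)
      then have "s \<in> S" using s b by (simp add: S_def)
      moreover have "\<phi> = tuple_add k s (restrict (\<lambda>i. app (- b i)) {..<k})"
      proof
        fix i show "\<phi> i = tuple_add k s (restrict (\<lambda>i. app (- b i)) {..<k}) i"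
          using \<phi> rep[OF \<phi>, of i]
          by (cases "i < k") (auto simp: tuple_add_def s_def app_plus app_uminus topspace_homk PiE_def extensional_def)
      qed
      ultimately show "\<phi> \<in> {tuple_add k s c | s c. s \<in> S \<and> c \<in> K}" using b(1) by (auto simp: K_def)
    next
      fix \<phi> :: "nat \<Rightarrow> 'g \<Rightarrow> 'g" assume "\<phi> \<in> {tuple_add k s c | s c. s \<in> S \<and> c \<in> K}"
      then obtain s c where "\<phi> = tuple_add k s c" "s \<in> topspace (homk_top k)" "c \<in> topspace (homk_top k)"
        using K by (auto simp: S_def)
      then show "\<phi> \<in> topspace (homk_top k)"
        by (auto simp: topspace_homk tuple_add_def Hom_def PiE_iff algebra_simps)
    qed
    ultimately show ?thesis unfolding syndetic_homk_def by blast
  qed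
  moreover have "S \<subseteq> topspace (homk_top k)" by (auto simp: S_def)
  moreover have "\<forall>\<phi>\<in>S. syndetic_discrete (R_eps M T A k \<epsilon> \<phi>)" using synd_R by (auto simp: S_def)
  ultimately show ?thesis by blast
qed

end
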